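(* Let $\beta\in\mathbb{Z}$, $p=1$ or $p=\infty$, $\alpha\ge1$ and $m\in\mathbb{Z}_+$. Then the equality $$E(\mathbf{W}^{r,\beta}_{p,1};\sigma_m^\alpha)_p=\frac4\pi\sum_{k=0}^\infty\frac{(-1)^{k(\beta+1)}}{(2k+1)^{r+1}}\left(1-\frac{A^\alpha_{m-(2k+1)}}{A^\alpha_m}\right)$$ holds at least in the following cases: 1) $\beta$ is odd, and $r=1$ or $r\ge2$; 2) $\beta$ is even, and $r=2$ or $r\ge3$. Moreover, in these two cases, for all $\alpha,\gamma\ge1$ and $m\in\mathbb{Z}_+$, $$E(\mathbf{W}^{r,\beta}_{p,1};\sigma_m^\alpha)_p=\frac1{A_m^\alpha}\sum_{k=0}^mA_{m-k}^{\alpha-\gamma-1}A_k^\gamma\,E(\mathbf{W}^{r,\beta}_{p,1};\sigma_k^\gamma)_p .$$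
   Context: $\mathbb{Z}_+=\{0,1,2,\dots\}$. $L_p$, $1\le p\le\infty$, is the space of $2\pi$-periodic real-valued measurable functions with finite norm $\|f\|_p=(\int_{-\pi}^{\pi}|f(t)|^p\,dt)^{1/p}$ for $p<\infty$ and $\|f\|_\infty=\operatorname{ess\,sup}_{[-\pi,\pi]}|f|$. Fourier coefficients: $\widehat{\varphi}(k)=\frac1{2\pi}\int_{-\pi}^{\pi}\varphi(t)e^{-ikt}\,dt$. $H_p^1=\{\varphi\in L_p:\|\varphi\|_p\le1,\ \widehat\varphi(0)=0\}$. For $r>0$ and $\beta\in\mathbb{R}$ put $$\psi_{r,\beta}(t)=\sum_{k\ne0}\frac{e^{-i\beta\pi\operatorname{sign}(k)/2}}{|k|^r}e^{ikt}=\sum_{k=1}^\infty\frac{2\cos(kt-\beta\pi/2)}{k^r};$$ this function belongs to $L_1$ and the series is its Fourier series. $\mathbf{W}^{r,\beta}_{p,1}$ is the class of all functions $f(x)=\frac1{2\pi}\int_{-\pi}^{\pi}\varphi(x-t)\psi_{r,\beta}(t)\,dt$ with $\varphi\in H_p^1$. For an operator $G$, $E(\mathbf{W}^{r,\beta}_{p,1};G)_p=\sup\{\|f-G(f)\|_p: f\in\mathbf{W}^{r,\beta}_{p,1}\}$. The Cesàro numbers $A_n^\alpha$ of order $\alpha\in\mathbb{R}$ are defined by $(1-x)^{-\alpha-1}=\sum_{n=0}^\infty A_n^\alpha x^n$, $|x|<1$, i.e. $A_0^\alpha=1$, $A_n^\alpha=(\alpha+1)\cdots(\alpha+n)/n!$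 for $n\ge1$; and $A_n^\alpha=0$ for negative integers $n$. The Cesàro means of order $\alpha>-1$ of $f\in L_1$ are $$\sigma_n^\alpha(f)(x)=\sum_{k=-n}^n\frac{A^\alpha_{n-|k|}}{A_n^\alpha}\widehat f(k)e^{ikx},\quad n\in\mathbb{Z}_+ .$$ *)

theory Defs
  imports "HOL-Probability.Essential_Supremum"
begin

abbreviation period :: "real measure"
  where "period \<equiv> lebesgue_on {-pi..pi}"

text \<open>The norm is taken with respect to unnormalised Lebesgue measure on the period.
  It is meaningful for \<open>1 \<le> p\<close>; \<open>p = \<infinity>\<close> gives the essential supremum.\<close>

definition Lp_norm :: "ennreal \<Rightarrow> (real \<Rightarrow> real) \<Rightarrow> ennreal"
  where "Lp_norm p f =
    (if p = \<infinity> then esssup period (\<lambda>t. ennreal \<bar>f t\<bar>)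
     else let I = (\<integral>\<^sup>+ t. ennreal (\<bar>f t\<bar> powr enn2real p) \<partial>period)
          in if I = \<infinity> then \<infinity> else ennreal (enn2real I powr (1 / enn2real p)))"

definition Lp_space :: "ennreal \<Rightarrow> (real \<Rightarrow> real) set"
  where "Lp_space p =
    {f. f \<in> borel_measurable lebesgue \<and> (\<forall>t. f (t + 2 * pi) = f t) \<and> Lp_norm p f < \<infinity>}"

definition fourier_coeff :: "(real \<Rightarrow> real) \<Rightarrow> int \<Rightarrow> complex"
  where "fourier_coeff f k =
    complex_of_real (1 / (2 * pi)) *
      (LINT t|period. complex_of_real (f t) * exp (- (\<i> * of_int k * complex_of_real t)))"

definition H1 :: "ennreal \<Rightarrow> (real \<Rightarrow> real) set"
  where "H1 p = {\<phi> \<in> Lp_space p. Lp_norm p \<phi> \<le> 1 \<and> fourier_coeff \<phi> 0 = 0}"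

text \<open>The summation index is shifted by one. The series may diverge only at multiples of
  \<open>2 * pi\<close>, where \<open>suminf\<close> is then unspecified; this null set does not affect
  the convolutions below.\<close>

definition psi :: "real \<Rightarrow> real \<Rightarrow> real \<Rightarrow> real"
  where "psi r \<beta> t =
    (\<Sum>j. 2 * cos (real (Suc j) * t - \<beta> * pi / 2) / real (Suc j) powr r)"

definition W1 :: "real \<Rightarrow> real \<Rightarrow> ennreal \<Rightarrow> (real \<Rightarrow> real) set"
  where "W1 r \<beta> p =
    {f. \<exists>\<phi>\<in>H1 p. \<forall>x. f x = 1 / (2 * pi) * (LINT t|period. \<phi> (x - t) * psi r \<beta> t)}"

text \<open>The supremum is formed in the extended reals, so no finiteness is presupposed.\<close>

definition approx_error ::
    "(real \<Rightarrow> real) set \<Rightarrow> ((real \<Rightarrow> real) \<Rightarrow> real \<Rightarrow> real) \<Rightarrow> ennreal \<Rightarrow> ereal"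
  where "approx_error W G p = (SUP f\<in>W. enn2ereal (Lp_norm p (\<lambda>x. f x - G f x)))"

definition cesaro_number :: "real \<Rightarrow> int \<Rightarrow> real"
  where "cesaro_number \<alpha> n =
    (if n < 0 then 0 else pochhammer (\<alpha> + 1) (nat n) / fact (nat n))"

text \<open>For real-valued \<open>f\<close> the defining complex sum is real, which justifies
  taking its real part; see \<open>of_real_cesaro_mean\<close>.\<close>

definition cesaro_mean :: "real \<Rightarrow> nat \<Rightarrow> (real \<Rightarrow> real) \<Rightarrow> real \<Rightarrow> real"
  where "cesaro_mean \<alpha> n f x =
    Re (\<Sum>k\<in>{- int n..int n}.
          complex_of_real (cesaro_number \<alpha> (int n - \<bar>k\<bar>) / cesaro_number \<alpha> (int n)) *
          fourier_coeff f k * exp (\<i> * of_int k * complex_of_real x))"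

lemma cnj_fourier_coeff: "cnj (fourier_coeff f k) = fourier_coeff f (- k)"
proof -
  have "cnj (LINT t|period. complex_of_real (f t) * exp (- (\<i> * of_int k * complex_of_real t)))
      = (LINT t|period. complex_of_real (f t) * exp (- (\<i> * of_int (- k) * complex_of_real t)))"
    unfolding Bochner_Integration.integral_cnj[symmetric]
    by (rule Bochner_Integration.integral_cong) (simp_all add: exp_cnj)
  then show ?thesis by (simp add: fourier_coeff_def)
qed

lemma of_real_cesaro_mean:
  "complex_of_real (cesaro_mean \<alpha> n f x) =
    (\<Sum>k\<in>{- int n..int n}.
       complex_of_real (cesaro_number \<alpha> (int n - \<bar>k\<bar>) / cesaro_number \<alpha> (int n)) *
       fourier_coeff f k * exp (\<i> * of_int k * complex_of_real x))"
  (is "_ = sum ?g _")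
proof -
  have "cnj (sum ?g {- int n..int n}) = (\<Sum>k\<in>{- int n..int n}. ?g (- k))"
    by (simp add: cnj_fourier_coeff exp_cnj)
  also have "\<dots> = sum ?g {- int n..int n}"
    by (rule sum.reindex_bij_witness[of _ uminus uminus]) auto
  finally have "sum ?g {- int n..int n} \<in> \<real>"
    by (simp only: Reals_cnj_iff)
  then show ?thesis
    unfolding cesaro_mean_def by (rule of_real_Re)
qed

lemma cesaro_number_sums:
  assumes "\<bar>x\<bar> < 1"
  shows "(\<lambda>n. cesaro_number \<alpha> (int n) * x ^ n) sums (1 - x) powr (- \<alpha> - 1)"
proof -
  have "(\<lambda>n. ((- \<alpha> - 1) gchoose n) * (- x) ^ n) sums (1 + - x) powr (- \<alpha> - 1)"
    by (rule gen_binomial_real) (use assms in simp)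
  moreover have "((- \<alpha> - 1) gchoose n) * (- x) ^ n = cesaro_number \<alpha> (int n) * x ^ n" for n
  proof -
    have "(- 1 :: real) ^ n * (- 1) ^ n = 1"
      by (simp flip: power_mult_distrib)
    then show ?thesis
      by (simp add: cesaro_number_def gbinomial_pochhammer power_minus[of x] add.commute)
  qed
  ultimately show ?thesis by simp
qed

end

theory Submission
  imports Defs
begin

text \<open>Write \<open>f - \<sigma>(f) = \<phi> * K / (2\<pi>)\<close> with
  \<open>K(t) = \<Sum>\<^sub>k 2 (1 - c\<^sub>k) cos (k t - \<theta>) / k\<^sup>r\<close>, where \<open>\<theta> = \<beta>\<pi>/2\<close> and
  \<open>c\<^sub>k\<close> is the Cesaro multiplier. If for some constant \<open>c\<close> the function \<open>K - c\<close> has everywhere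
  the sign of \<open>s(t) = sgn cos (t - \<theta>)\<close>, then the error is the \<open>L\<^sub>1\<close> norm of
  \<open>(K - c) / (2\<pi>)\<close>, that is \<open>1/(2\<pi>) \<integral> K s\<close>, which the Fourier series of \<open>s\<close> evaluates.
  The lower bound is attained by a reflection of \<open>s\<close> for \<open>p = \<infinity>\<close>, and approached by
  normalised differences of bumps at \<open>0\<close> and \<open>\<pi>\<close> for \<open>p = 1\<close>.

  For odd \<open>\<beta>\<close> the sign property is positivity on \<open>(0,\<pi>)\<close> of a sine series with coefficients
  \<open>(1 - c\<^sub>k) / k\<^sup>q\<close>, \<open>q = r\<close>; for even \<open>\<beta>\<close> it is monotonicity of a cosine series, whose
  derivative is such a sine series with \<open>q = r - 1\<close>. By the Vandermonde identity for Cesaro numbers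
  \<open>1 - c\<^sub>k\<close> is a nonnegative combination of the sequences \<open>min k n\<close>, for which positivity
  follows from that of the Fejer kernel (\<open>q = 1\<close>) or the Fejer-Jackson inequality (\<open>q \<ge> 2\<close>).\<close>

subsection \<open>Positive sine series\<close>

text \<open>The two ranges of \<open>q\<close> come from two positivity arguments that do not
  interpolate. Relative to \<open>sin (k t) / k\<close> the series with \<open>min k N\<close> has
  the weights \<open>min k N * k powr (1 - q)\<close>, which increase up to \<open>k = N\<close> as
  soon as \<open>q < 2\<close>; Abel summation is thus confined to \<open>q \<ge> 2\<close>, while
  \<open>q = 1\<close> admits a closed form. The condition \<open>\<alpha> \<ge> 1\<close> makes the
  combination weights nonnegative: they are Cesaro numbers of order \<open>\<alpha> - 2\<close>. The
  analytic obstacle is that for \<open>q = 1\<close> the sine series converges only conditionally,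
  and not uniformly near 0. Its partial sums are uniformly bounded, however, and every interchange
  of sum and integral rests on this and dominated convergence. The sign condition is demanded at
  every point of the period, also at the zeros of \<open>s\<close>, where \<open>sgn\<close> is 0
  and \<open>K\<close> must equal \<open>c\<close>. The formula relating two orders needs no
  extremal argument: it is the Vandermonde identity applied to each term of the explicit
  series.\<close>

text \<open>The factor \<open>2 * sin (x / 2)\<close> makes the sum telescope. Keeping it on the
  left avoids a division and leaves the identity valid at multiples of
  \<open>2 * pi\<close>.\<close>

lemma dirichlet_sum:
  "2 * sin (x / 2) * (\<Sum>j<n. cos (real (Suc j) * x)) = sin ((real n + 1 / 2) * x) - sin (x / 2)"
proof (induction n)
  case 0
  show ?case by simp
next
  case (Suc n)
  have "2 * sin (x / 2) * cos (real (Suc n) * x)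
      = sin (x / 2 + real (Suc n) * x) + sin (x / 2 - real (Suc n) * x)"
    by (simp add: sin_add sin_diff)
  also have "x / 2 - real (Suc n) * x = - ((real n + 1 / 2) * x)"
    by (simp add: algebra_simps)
  also have "x / 2 + real (Suc n) * x = (real (Suc n) + 1 / 2) * x"
    by (simp add: algebra_simps)
  finally show ?case
    using Suc.IH by (simp add: distrib_left del: of_nat_Suc)
qed

lemma DERIV_sine_sum:
  "((\<lambda>x. \<Sum>j<n. c j * sin (real (Suc j) * x) / real (Suc j)) has_field_derivative
     (\<Sum>j<n. c j * cos (real (Suc j) * x))) (at x)"
  by (rule DERIV_sum) (auto intro!: derivative_eq_intros simp del: of_nat_Suc)

text \<open>At an interior critical point \<open>x\<close> of the \<open>n\<close>-th sum one has
  \<open>sin ((n + 1/2) x) = sin (x/2)\<close>, which forces \<open>sin (n x) \<ge> 0\<close>; so the minimum of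
  the \<open>n\<close>-th sum is bounded below by a value of its predecessor.\<close>

lemma fejer_jackson:
  assumes "0 \<le> t" "t \<le> pi"
  shows "0 \<le> (\<Sum>j<n. sin (real (Suc j) * t) / real (Suc j))"
  using assms
proof (induction n arbitrary: t)
  case 0
  show ?case by simp
next
  case (Suc n)
  define f where "f x = (\<Sum>j<Suc n. sin (real (Suc j) * x) / real (Suc j))" for x
  have deriv: "(f has_field_derivative (\<Sum>j<Suc n. cos (real (Suc j) * x))) (at x)" for x
    using DERIV_sine_sum[where c = "\<lambda>_. 1" and n = "Suc n" and x = x] unfolding f_def by simp
  have "continuous_on {0..pi} f"
    using deriv by (meson DERIV_continuous continuous_at_imp_continuous_on)
  then obtain x where x: "x \<in> {0..pi}" and min: "\<And>y. y \<in> {0..pi} \<Longrightarrow> f x \<le> f y"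
    using continuous_attains_inf[of "{0..pi}" f] by auto
  have "0 \<le> f x"
  proof (cases "x = 0 \<or> x = pi")
    case True
    then show ?thesis by (auto simp: f_def simp del: of_nat_Suc intro!: sum_nonneg)
  next
    case False
    then have "0 < x" "x < pi" using x by auto
    have "(\<Sum>j<Suc n. cos (real (Suc j) * x)) = 0"
    proof (rule DERIV_local_min[OF deriv])
      show "0 < min x (pi - x)" using \<open>0 < x\<close> \<open>x < pi\<close> by simp
      show "\<forall>y. \<bar>x - y\<bar> < min x (pi - x) \<longrightarrow> f x \<le> f y"
        using min by (auto simp: abs_if split: if_splits)
    qed
    then have sin_eq: "sin ((real (Suc n) + 1 / 2) * x) = sin (x / 2)"
      using dirichlet_sum[of x "Suc n"] by simp
    \<comment> \<open>Equal sines leave the two cosines equal up to sign; as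
      \<open>cos (x / 2)\<close> is nonnegative, it is the larger one.\<close>
    have "(cos ((real (Suc n) + 1 / 2) * x))\<^sup>2 = (cos (x / 2))\<^sup>2"
      unfolding cos_squared_eq sin_eq ..
    then have "\<bar>cos ((real (Suc n) + 1 / 2) * x)\<bar> = \<bar>cos (x / 2)\<bar>"
      by (simp add: power2_eq_iff abs_eq_iff)
    moreover have "0 \<le> cos (x / 2)"
      using \<open>0 < x\<close> \<open>x < pi\<close> by (intro cos_ge_zero) auto
    ultimately have cos_le: "cos ((real (Suc n) + 1 / 2) * x) \<le> cos (x / 2)"
      by linarith
    have "sin (real (Suc n) * x) = sin ((real (Suc n) + 1 / 2) * x - x / 2)"
      by (simp add: algebra_simps)
    also have "\<dots> = sin (x / 2) * (cos (x / 2) - cos ((real (Suc n) + 1 / 2) * x))"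
      unfolding sin_diff sin_eq by (simp add: algebra_simps)
    also have "\<dots> \<ge> 0"
      using cos_le \<open>0 < x\<close> \<open>x < pi\<close> by (intro mult_nonneg_nonneg sin_ge_zero) auto
    finally have "0 \<le> sin (real (Suc n) * x) / real (Suc n)"
      by (intro divide_nonneg_nonneg) auto
    then show ?thesis
      using Suc.IH[of x] \<open>0 < x\<close> \<open>x < pi\<close> by (simp add: f_def del: of_nat_Suc)
  qed
  also have "f x \<le> f t"
    using min Suc.prems by simp
  finally show ?case by (simp only: f_def)
qed

text \<open>The right side is the squared modulus of the sum of \<open>exp (i k t)\<close> over
  \<open>k < N\<close>, so the left side, \<open>N\<close> times the Fejer kernel, is nonnegative.
  The induction adds one exponential and expands the square.\<close>

lemma fejer_kernel_eq:
  "real N + 2 * (\<Sum>j<N. real (N - Suc j) * cos (real (Suc j) * t)) =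
    (\<Sum>k<N. cos (real k * t))\<^sup>2 + (\<Sum>k<N. sin (real k * t))\<^sup>2"
proof (induction N)
  case 0
  show ?case by simp
next
  case (Suc N)
  have 1: "(\<Sum>j<Suc N. real (Suc N - Suc j) * cos (real (Suc j) * t))
      = (\<Sum>j<N. real (N - Suc j) * cos (real (Suc j) * t)) + (\<Sum>j<N. cos (real (Suc j) * t))"
    unfolding sum.distrib[symmetric] by (auto intro!: sum.cong simp: of_nat_diff algebra_simps)
  \<comment> \<open>The cross term of the new exponential with the old ones: the differences
    \<open>N - k\<close> for \<open>k < N\<close> run through \<open>1..N\<close>.\<close>
  have 2: "cos (real N * t) * (\<Sum>k<N. cos (real k * t)) + sin (real N * t) * (\<Sum>k<N. sin (real k * t))
      = (\<Sum>j<N. cos (real (Suc j) * t))"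
  proof -
    have "cos (real N * t) * (\<Sum>k<N. cos (real k * t)) + sin (real N * t) * (\<Sum>k<N. sin (real k * t))
        = (\<Sum>k<N. cos (real N * t - real k * t))"
      by (simp add: cos_diff sum.distrib sum_distrib_left)
    also have "\<dots> = (\<Sum>k<N. cos (real (Suc (N - Suc k)) * t))"
      by (intro sum.cong) (auto simp: of_nat_diff algebra_simps Suc_diff_Suc simp del: of_nat_Suc)
    also have "\<dots> = (\<Sum>k<N. cos (real (Suc k) * t))"
      by (rule sum.nat_diff_reindex)
    finally show ?thesis .
  qed
  have 3: "(cos (real N * t))\<^sup>2 + (sin (real N * t))\<^sup>2 = 1"
    by simp
  have 4: "n + 1 + 2 * (P + Q) = C\<^sup>2 + c\<^sup>2 + 2 * C * c + (S\<^sup>2 + s\<^sup>2 + 2 * S * s)"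
    if "c * C + s * S = Q" "c\<^sup>2 + s\<^sup>2 = 1" "n + 2 * P = C\<^sup>2 + S\<^sup>2" for n P Q C S c s :: real
    unfolding that(1)[symmetric] using that(2,3) by (simp add: algebra_simps)
  have "real (Suc N) = real N + 1" by simp
  then show ?case
    unfolding 1 unfolding sum.lessThan_Suc power2_sum using 4[OF 2 3 Suc.IH] by argo
qed

text \<open>The difference of the two sides vanishes at \<open>pi\<close>, and its derivative is
  minus one half of the nonnegative expression in \<open>fejer_kernel_eq\<close>, so it decreases
  towards 0. The sum is \<open>N\<close> times a Fejer mean of the sawtooth
  \<open>(pi - t) / 2\<close>.\<close>

lemma fejer_mean_sawtooth_le:
  assumes "t \<le> pi"
  shows "(\<Sum>j<N. real (N - Suc j) * sin (real (Suc j) * t) / real (Suc j)) \<le> real N * (pi - t) / 2"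
proof -
  define G where "G x = real N * (pi - x) / 2 -
    (\<Sum>j<N. real (N - Suc j) * sin (real (Suc j) * x) / real (Suc j))" for x
  have "G pi \<le> G t"
  proof (rule DERIV_nonpos_imp_nonincreasing[OF assms])
    fix x
    have "(G has_field_derivative
        - real N / 2 - (\<Sum>j<N. real (N - Suc j) * cos (real (Suc j) * x))) (at x)"
      unfolding G_def by (rule DERIV_diff[OF _ DERIV_sine_sum]) (auto intro!: derivative_eq_intros)
    moreover have "0 \<le> real N + 2 * (\<Sum>j<N. real (N - Suc j) * cos (real (Suc j) * x))"
      unfolding fejer_kernel_eq by simp
    ultimately show "\<exists>y. (G has_field_derivative y) (at x) \<and> y \<le> 0"
      by (intro exI[of _ "- real N / 2 - (\<Sum>j<N. real (N - Suc j) * cos (real (Suc j) * x))"] conjI) linarith+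
  qed
  then show ?thesis by (simp add: G_def del: of_nat_Suc)
qed

text \<open>Splitting \<open>n = (n - k) + k\<close> writes \<open>n\<close> times the sum as a
  Fejer mean, at most \<open>n * pi / 2\<close>, plus \<open>n\<close> sines, each at most 1. The
  lower bound for \<open>t \<ge> 0\<close> is Fejer-Jackson. Uniformity in \<open>n\<close> and
  \<open>t\<close> provides the dominating function for the series with
  \<open>q = 1\<close>.\<close>

lemma abs_sine_sum_le:
  assumes "\<bar>t\<bar> \<le> pi"
  shows "\<bar>\<Sum>j<n. sin (real (Suc j) * t) / real (Suc j)\<bar> \<le> pi / 2 + 1"
proof -
  have nonneg: "\<bar>\<Sum>j<n. sin (real (Suc j) * t) / real (Suc j)\<bar> \<le> pi / 2 + 1"
    if t: "0 \<le> t" "t \<le> pi" for t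
  proof (cases "n = 0")
    case False
    have "real n * (\<Sum>j<n. sin (real (Suc j) * t) / real (Suc j))
        = (\<Sum>j<n. real (n - Suc j) * sin (real (Suc j) * t) / real (Suc j) + sin (real (Suc j) * t))"
      unfolding sum_distrib_left by (intro sum.cong) (auto simp: of_nat_diff field_simps)
    also have "\<dots> \<le> real n * (pi - t) / 2 + (\<Sum>j<n. 1)"
      unfolding sum.distrib using fejer_mean_sawtooth_le[OF t(2)]
      by (intro add_mono sum_mono) auto
    also have "\<dots> \<le> real n * (pi / 2 + 1)"
      using t by (simp add: field_simps)
    finally show ?thesis
      using fejer_jackson[OF t, of n] False by (simp del: of_nat_Suc)
  qed (use pi_gt_zero in simp)
  show ?thesis
  proof (cases "0 \<le> t")
    case False
    have "\<bar>\<Sum>j<n. sin (real (Suc j) * t) / real (Suc j)\<bar>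
        = \<bar>\<Sum>j<n. sin (real (Suc j) * (- t)) / real (Suc j)\<bar>"
      by (simp add: sum_negf del: of_nat_Suc)
    then show ?thesis using nonneg[of "- t"] assms False by simp
  qed (use nonneg assms in simp)
qed

text \<open>The error \<open>S n x - (pi - x) / 2\<close> has derivative
  \<open>sin ((n + 1/2) x) / (2 sin (x/2))\<close>, which oscillates without becoming small. Adding
  the correction \<open>C n\<close> amounts to one integration by parts: it cancels this term and
  leaves a derivative of order \<open>1 / n\<close>. The mean value theorem on
  \<open>{t..pi}\<close> then compares with the value 0 at \<open>pi\<close>.\<close>

lemma sawtooth_sums:
  assumes "0 < t" "t \<le> pi"
  shows "(\<lambda>j. sin (real (Suc j) * t) / real (Suc j)) sums ((pi - t) / 2)"
proof -
  define S where "S n x = (\<Sum>j<n. sin (real (Suc j) * x) / real (Suc j))" for n x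
  define C where "C n x = cos ((real n + 1 / 2) * x) / ((2 * real n + 1) * sin (x / 2))" for n x
  define d where "d = sin (t / 2)"
  have "0 < d"
    using assms unfolding d_def by (intro sin_gt_zero) auto
  have d_le: "d \<le> sin (x / 2)" if "t \<le> x" "x \<le> pi" for x
    using that assms unfolding d_def by (intro sin_monotone_2pi_le) auto
  \<comment> \<open>The summand \<open>pi / d\<^sup>2\<close> is the length of the interval times
    the bound for \<open>g'\<close>; the summand \<open>1 / d\<close> bounds the correction
    \<open>C n t\<close> itself.\<close>
  have bound: "\<bar>S n t - (pi - t) / 2\<bar> \<le> (pi / d\<^sup>2 + 1 / d) * inverse (real (Suc n))" for n
  proof -
    define g where "g x = S n x - (pi - x) / 2 + C n x" for x
    define g' where "g' x = - cos ((real n + 1 / 2) * x) * cos (x / 2) /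
      (2 * (2 * real n + 1) * (sin (x / 2))\<^sup>2)" for x
    have n_pos: "2 * real n + 1 > 0" by simp
    have deriv: "(g has_field_derivative g' x) (at x)" if "t \<le> x" "x \<le> pi" for x
    proof -
      have s: "sin (x / 2) > 0" using d_le[OF that] \<open>0 < d\<close> by linarith
      have 1: "(S n has_field_derivative (\<Sum>j<n. cos (real (Suc j) * x))) (at x)"
        using DERIV_sine_sum[where c = "\<lambda>_. 1" and n = n and x = x] unfolding S_def by simp
      have 2: "(C n has_field_derivative
          (- sin ((real n + 1 / 2) * x) * (real n + 1 / 2) * ((2 * real n + 1) * sin (x / 2)) -
            cos ((real n + 1 / 2) * x) * ((2 * real n + 1) * (cos (x / 2) / 2))) /
          (((2 * real n + 1) * sin (x / 2)) * ((2 * real n + 1) * sin (x / 2)))) (at x)"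
        unfolding C_def using s n_pos
        by (auto intro!: derivative_eq_intros simp del: of_nat_Suc)
      have 3: "(\<Sum>j<n. cos (real (Suc j) * x)) = (sin ((real n + 1 / 2) * x) - sin (x / 2)) / (2 * sin (x / 2))"
        using dirichlet_sum[of x n] s by (simp add: field_simps)
      have "(g has_field_derivative (\<Sum>j<n. cos (real (Suc j) * x)) + 1 / 2 +
         (- sin ((real n + 1 / 2) * x) * (real n + 1 / 2) * ((2 * real n + 1) * sin (x / 2)) -
            cos ((real n + 1 / 2) * x) * ((2 * real n + 1) * (cos (x / 2) / 2))) /
          (((2 * real n + 1) * sin (x / 2)) * ((2 * real n + 1) * sin (x / 2)))) (at x)"
        unfolding g_def by (rule derivative_eq_intros 1 2 refl | simp)+
      moreover have "(\<Sum>j<n. cos (real (Suc j) * x)) + 1 / 2 +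
         (- sin ((real n + 1 / 2) * x) * (real n + 1 / 2) * ((2 * real n + 1) * sin (x / 2)) -
            cos ((real n + 1 / 2) * x) * ((2 * real n + 1) * (cos (x / 2) / 2))) /
          (((2 * real n + 1) * sin (x / 2)) * ((2 * real n + 1) * sin (x / 2))) = g' x"
      proof -
        define y where "y = 2 * real n + 1"
        define a b c where "a = sin (y / 2 * x)" and "b = cos (y / 2 * x)" and "c = sin (x / 2)"
        have nz: "c \<noteq> 0" "y \<noteq> 0" using s n_pos by (auto simp: c_def y_def)
        have h: "real n + 1 / 2 = y / 2" by (simp add: y_def)
        have "(a - c) / (2 * c) + 1 / 2 +
            (- a * (y / 2) * (y * c) - b * (y * (cos (x / 2) / 2))) / ((y * c) * (y * c))
          = - b * cos (x / 2) / (2 * y * c\<^sup>2)"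
          using nz by (simp add: field_simps power2_eq_square)
        then show ?thesis
          unfolding 3 g'_def y_def[symmetric] h a_def b_def c_def .
      qed
      ultimately show ?thesis by simp
    qed
    have g_pi: "g pi = 0"
    proof -
      have "(real n + 1 / 2) * pi = real n * pi + pi / 2" by (simp add: algebra_simps)
      then have "cos ((real n + 1 / 2) * pi) = 0" by (simp add: cos_add)
      then show ?thesis by (simp add: g_def S_def C_def del: of_nat_Suc)
    qed
    have g'_le: "\<bar>g' x\<bar> \<le> inverse (real (Suc n)) / d\<^sup>2" if "t \<le> x" "x \<le> pi" for x
    proof -
      have "\<bar>g' x\<bar> = \<bar>cos ((real n + 1 / 2) * x)\<bar> * \<bar>cos (x / 2)\<bar> /
          (2 * (2 * real n + 1) * (sin (x / 2))\<^sup>2)"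
        using n_pos by (simp add: g'_def abs_mult)
      also have "\<dots> \<le> 1 * 1 / (real (Suc n) * d\<^sup>2)"
        using \<open>0 < d\<close> d_le[OF that]
        by (intro frac_le mult_mono power_mono) auto
      finally show ?thesis by (simp add: field_simps)
    qed
    have g_t: "\<bar>g t\<bar> \<le> pi / d\<^sup>2 * inverse (real (Suc n))"
    proof (cases "t = pi")
      case False
      then have "t < pi" using assms by simp
      then obtain z where z: "t < z" "z < pi" "g pi - g t = (pi - t) * g' z"
        using MVT2[of t pi g g'] deriv by auto
      then have "\<bar>g t\<bar> = (pi - t) * \<bar>g' z\<bar>"
        using g_pi \<open>t < pi\<close> by (simp add: abs_mult_pos' flip: abs_minus_cancel[of "g t"])
      also have "\<dots> \<le> pi * (inverse (real (Suc n)) / d\<^sup>2)"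
        using assms z g'_le[of z] by (intro mult_mono) auto
      finally show ?thesis by simp
    qed (use g_pi in simp)
    have "\<bar>C n t\<bar> = \<bar>cos ((real n + 1 / 2) * t)\<bar> / ((2 * real n + 1) * d)"
      using \<open>0 < d\<close> n_pos by (simp add: C_def abs_mult d_def)
    also have "\<dots> \<le> 1 / (real (Suc n) * d)"
      using \<open>0 < d\<close> by (intro frac_le mult_mono) auto
    finally have "\<bar>C n t\<bar> \<le> 1 / d * inverse (real (Suc n))"
      by (simp add: field_simps)
    with g_t show ?thesis
      by (simp add: g_def distrib_right del: of_nat_Suc)
  qed
  have "(\<lambda>n. S n t - (pi - t) / 2) \<longlonglongrightarrow> 0"
  proof (rule Lim_null_comparison)
    show "\<forall>\<^sub>F n in sequentially. norm (S n t - (pi - t) / 2) \<le> (pi / d\<^sup>2 + 1 / d) * inverse (real (Suc n))"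
      using bound by simp
    show "(\<lambda>n. (pi / d\<^sup>2 + 1 / d) * inverse (real (Suc n))) \<longlonglongrightarrow> 0"
      by (rule tendsto_mult_right_zero[OF LIMSEQ_inverse_real_of_nat])
  qed
  then show ?thesis
    unfolding sums_def S_def by (simp add: LIM_zero_iff)
qed

text \<open>Abel summation as an induction: the weighted sum dominates its last weight times the
  plain partial sum, because lowering that weight can only decrease a product with a nonnegative
  sum.\<close>

lemma sum_antimono_weights_nonneg:
  fixes a b :: "nat \<Rightarrow> real"
  assumes "\<And>n. 0 \<le> (\<Sum>j<n. a j)" and "decseq b" and "\<And>j. 0 \<le> b j"
  shows "0 \<le> (\<Sum>j<n. b j * a j)"
proof (cases n)
  case (Suc m)
  have "b m * (\<Sum>j<Suc m. a j) \<le> (\<Sum>j<Suc m. b j * a j)" for m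
  proof (induction m)
    case (Suc m)
    have "b (Suc m) * (\<Sum>j<Suc m. a j) \<le> b m * (\<Sum>j<Suc m. a j)"
      using assms(1)[of "Suc m"] decseq_SucD[OF assms(2)] by (intro mult_right_mono)
    with Suc.IH show ?case by (simp add: distrib_left)
  qed simp
  from this[of m] show ?thesis
    using mult_nonneg_nonneg[OF assms(3)[of m] assms(1)[of n]] unfolding Suc by linarith
qed simp

section \<open>Sine series with the coefficients \<open>min k N\<close>\<close>

lemma summable_inverse_squares_Suc: "summable (\<lambda>j. 1 / real (Suc j) ^ 2)"
  using inverse_power_summable[of 2, where 'a = real]
  by (subst summable_Suc_iff[of "\<lambda>j. 1 / real j ^ 2"]) (simp add: inverse_eq_divide)

text \<open>For \<open>q = 1\<close> convergence is conditional: from \<open>j = N\<close> on the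
  terms are those of \<open>N\<close> times the sawtooth series.\<close>

lemma summable_min_sine:
  assumes "q = 1 \<or> q \<ge> (2 :: real)" "0 \<le> t" "t \<le> pi"
  shows "summable (\<lambda>j. real (min (Suc j) N) * sin (real (Suc j) * t) / real (Suc j) powr q)"
proof (cases "q \<ge> 2")
  case True
  show ?thesis
  proof (rule summable_comparison_test')
    show "summable (\<lambda>j. real N * (1 / real (Suc j) ^ 2))"
      by (intro summable_mult summable_inverse_squares_Suc)
    fix j :: nat assume "0 \<le> j"
    have "norm (real (min (Suc j) N) * sin (real (Suc j) * t) / real (Suc j) powr q)
        = real (min (Suc j) N) * \<bar>sin (real (Suc j) * t)\<bar> / real (Suc j) powr q"
      by (simp add: abs_mult del: of_nat_Suc)
    also have "\<dots> \<le> real N * 1 / real (Suc j) powr 2"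
      using True by (intro frac_le mult_mono powr_mono) auto
    finally show "norm (real (min (Suc j) N) * sin (real (Suc j) * t) / real (Suc j) powr q)
        \<le> real N * (1 / real (Suc j) ^ 2)"
      by (simp add: powr_numeral del: of_nat_Suc)
  qed
next
  case False
  then have q: "q = 1" using assms by simp
  show ?thesis
  proof (cases "t = 0")
    case False
    then have "(\<lambda>j. real N * (sin (real (Suc j) * t) / real (Suc j))) sums (real N * ((pi - t) / 2))"
      using assms by (intro sums_mult sawtooth_sums) auto
    then have "summable (\<lambda>j. real N * (sin (real (Suc j) * t) / real (Suc j)))"
      by (rule sums_summable)
    then show ?thesis
      by (rule summable_cong[THEN iffD1, rotated])
        (auto simp: q eventually_sequentially intro!: exI[of _ N])
  qed simp
qed

text \<open>For \<open>q = 1\<close> the series is \<open>N\<close> times the sawtooth minus a Fejer mean of it;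
  for \<open>q \<ge> 2\<close> the factor in front of \<open>sin (k t) / k\<close> is decreasing in \<open>k\<close>,
  so Abel summation reduces the claim to the Fejer-Jackson inequality.\<close>

lemma min_sine_series_nonneg:
  assumes "q = 1 \<or> q \<ge> (2 :: real)" "0 \<le> t" "t \<le> pi"
  shows "0 \<le> (\<Sum>j. real (min (Suc j) N) * sin (real (Suc j) * t) / real (Suc j) powr q)"
proof (cases "q \<ge> 2")
  case True
  \<comment> \<open>With \<open>k = Suc j\<close> the weight is \<open>k powr (2 - q)\<close> up to
    \<open>k = N\<close> and \<open>N * k powr (1 - q)\<close> beyond, which explains the case
    distinction on \<open>Suc j < N\<close>.\<close>
  define b where "b j = real (min (Suc j) N) * real (Suc j) powr (1 - q)" for j
  have "decseq b"
  proof (rule decseq_SucI)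
    fix j
    show "b (Suc j) \<le> b j"
    proof (cases "Suc j < N")
      case True
      have b_eq: "b i = real (Suc i) powr (2 - q)" if "Suc i \<le> N" for i
      proof -
        have "b i = real (Suc i) powr 1 * real (Suc i) powr (1 - q)"
          using that by (simp add: b_def)
        also have "\<dots> = real (Suc i) powr (2 - q)"
          unfolding powr_add[symmetric] by simp
        finally show ?thesis .
      qed
      have "real (Suc (Suc j)) powr (2 - q) \<le> real (Suc j) powr (2 - q)"
        using \<open>2 \<le> q\<close> by (intro powr_mono2') auto
      then show ?thesis using True by (simp add: b_eq del: of_nat_Suc)
    next
      case False
      have "real (Suc (Suc j)) powr (1 - q) \<le> real (Suc j) powr (1 - q)"
        using \<open>2 \<le> q\<close> by (intro powr_mono2') auto
      then show ?thesis
        using False by (simp add: b_def min_absorb2 mult_left_mono del: of_nat_Suc)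
    qed
  qed
  have "0 \<le> (\<Sum>j<n. b j * (sin (real (Suc j) * t) / real (Suc j)))" for n
    by (intro sum_antimono_weights_nonneg fejer_jackson assms \<open>decseq b\<close>) (simp add: b_def)
  moreover have "b j * (sin (real (Suc j) * t) / real (Suc j))
      = real (min (Suc j) N) * sin (real (Suc j) * t) / real (Suc j) powr q" for j
    by (simp add: b_def powr_diff del: of_nat_Suc)
  ultimately show ?thesis
    by (intro suminf_nonneg[OF summable_min_sine] LIMSEQ_le_const[OF summable_LIMSEQ[OF summable_min_sine]])
      (use assms in auto)
next
  case False
  then have q: "q = 1" using assms by simp
  show ?thesis
  proof (cases "t = 0")
    case False
    have "(\<lambda>j. real N * (sin (real (Suc j) * t) / real (Suc j))) sums (real N * ((pi - t) / 2))"
      using assms False by (intro sums_mult sawtooth_sums) auto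
    moreover have "(\<lambda>j. real (N - Suc j) * sin (real (Suc j) * t) / real (Suc j)) sums
        (\<Sum>j<N. real (N - Suc j) * sin (real (Suc j) * t) / real (Suc j))"
      by (rule sums_finite) auto
    ultimately have "(\<lambda>j. real N * (sin (real (Suc j) * t) / real (Suc j)) -
          real (N - Suc j) * sin (real (Suc j) * t) / real (Suc j)) sums
        (real N * ((pi - t) / 2) - (\<Sum>j<N. real (N - Suc j) * sin (real (Suc j) * t) / real (Suc j)))"
      by (rule sums_diff)
    moreover have "real N * (sin (real (Suc j) * t) / real (Suc j)) -
          real (N - Suc j) * sin (real (Suc j) * t) / real (Suc j)
        = real (min (Suc j) N) * sin (real (Suc j) * t) / real (Suc j) powr q" for j
    proof -
      \<comment> \<open>Natural subtraction truncates at 0; this produces the minimum.\<close>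
      have "real N - real (N - Suc j) = real (min (Suc j) N)" by linarith
      then show ?thesis by (simp add: q flip: diff_divide_distrib left_diff_distrib)
    qed
    ultimately show ?thesis
      using fejer_mean_sawtooth_le[OF assms(3), of N] by (simp add: sums_iff)
  qed simp
qed

section \<open>Cesaro numbers and their convolution identities\<close>

text \<open>The endpoint \<open>a = - 1\<close>, where the sequence is 1, 0, 0, ..., must be
  covered: it is the order \<open>\<alpha> - 2\<close> for \<open>\<alpha> = 1\<close>.\<close>

lemma cesaro_number_nonneg:
  assumes "- 1 \<le> a"
  shows "0 \<le> cesaro_number a n"
proof (cases "a = - 1")
  case True
  then show ?thesis by (simp add: cesaro_number_def pochhammer_0_left)
qed (use assms in \<open>simp add: cesaro_number_def pochhammer_nonneg\<close>)

lemma cesaro_number_pos: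
  assumes "- 1 < a" "0 \<le> n"
  shows "0 < cesaro_number a n"
  using assms by (simp add: cesaro_number_def pochhammer_pos)

lemma cesaro_number_one: "cesaro_number 1 (int n) = real n + 1"
proof -
  have "pochhammer (2 :: real) n = fact (Suc n)"
    using pochhammer_rec[of "1 :: real" n] by (simp add: pochhammer_fact)
  then show ?thesis by (simp add: cesaro_number_def)
qed

text \<open>Comparison of coefficients in the product of \<open>(1 - x) powr (- a - 1)\<close> and
  \<open>(1 - x) powr (- b - 1)\<close>, obtained here from the binomial theorem for rising
  factorials and hence valid for all real orders.\<close>

lemma cesaro_number_vandermonde:
  "(\<Sum>k=0..m. cesaro_number a (int m - int k) * cesaro_number b (int k)) = cesaro_number (a + b + 1) (int m)"
proof -
  have "cesaro_number (a + b + 1) (int m) = pochhammer ((b + 1) + (a + 1)) m / fact m"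
    by (simp add: cesaro_number_def algebra_simps)
  also have "\<dots> = (\<Sum>k\<le>m. real (m choose k) * pochhammer (b + 1) k * pochhammer (a + 1) (m - k) / fact m)"
    unfolding pochhammer_binomial_sum sum_divide_distrib ..
  also have "\<dots> = (\<Sum>k\<le>m. cesaro_number a (int m - int k) * cesaro_number b (int k))"
    by (intro sum.cong) (auto simp: cesaro_number_def binomial_fact field_simps nat_diff_distrib)
  finally show ?thesis by (simp add: atMost_atLeast0)
qed

text \<open>Numbers at negative arguments are 0, so the terms with \<open>k < i\<close> drop out and
  the rest is the unshifted identity for \<open>m - i\<close>; for \<open>i > m\<close> both sides
  vanish.\<close>

lemma cesaro_number_vandermonde_shift:
  "(\<Sum>k=0..m. cesaro_number a (int m - int k) * cesaro_number b (int k - int i)) =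
    cesaro_number (a + b + 1) (int m - int i)"
proof (cases "i \<le> m")
  case True
  have "(\<Sum>k=0..m. cesaro_number a (int m - int k) * cesaro_number b (int k - int i))
      = (\<Sum>k=i..m. cesaro_number a (int m - int k) * cesaro_number b (int k - int i))"
    by (rule sum.mono_neutral_right) (auto simp: cesaro_number_def)
  also have "\<dots> = (\<Sum>k=0..m-i. cesaro_number a (int (m - i) - int k) * cesaro_number b (int k))"
    using True by (intro sum.reindex_bij_witness[of _ "\<lambda>k. k + i" "\<lambda>k. k - i"]) (auto simp: of_nat_diff)
  finally show ?thesis
    using True unfolding cesaro_number_vandermonde by (simp add: of_nat_diff)
next
  case False
  then show ?thesis
    by (auto simp: cesaro_number_def intro!: sum.neutral)
qed

text \<open>Orders \<open>a - 2\<close> and \<open>1\<close> combine to order \<open>a\<close>. In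
  order 1 the numbers are linear, equal to \<open>n + 1\<close>, so the difference between the
  numbers at \<open>n\<close> and at \<open>n - i\<close> is \<open>min i (n + 1)\<close>.\<close>

lemma cesaro_defect_eq_sum:
  assumes "- 1 < a"
  shows "1 - cesaro_number a (int m - int i) / cesaro_number a (int m) =
    (\<Sum>n=0..m. cesaro_number (a - 2) (int m - int n) / cesaro_number a (int m) * real (min i (Suc n)))"
proof -
  have pos: "cesaro_number a (int m) > 0"
    using assms by (intro cesaro_number_pos) auto
  have "cesaro_number a (int m) - cesaro_number a (int m - int i)
      = (\<Sum>n=0..m. cesaro_number (a - 2) (int m - int n) * cesaro_number 1 (int n)) -
        (\<Sum>n=0..m. cesaro_number (a - 2) (int m - int n) * cesaro_number 1 (int n - int i))"
    unfolding cesaro_number_vandermonde cesaro_number_vandermonde_shift by simp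
  also have "\<dots> = (\<Sum>n=0..m. cesaro_number (a - 2) (int m - int n) * real (min i (Suc n)))"
  proof -
    have "cesaro_number 1 (int n) - cesaro_number 1 (int n - int i) = real (min i (Suc n))" for n
      using cesaro_number_one[of n] cesaro_number_one[of "n - i"]
      by (cases "i \<le> n") (auto simp: of_nat_diff cesaro_number_def)
    then show ?thesis
      by (simp only: sum_subtractf[symmetric] right_diff_distrib[symmetric])
  qed
  finally show ?thesis
    using pos by (simp add: sum_divide_distrib[symmetric] field_simps)
qed

lemma cesaro_sine_series:
  assumes "q = 1 \<or> q \<ge> (2 :: real)" "0 \<le> t" "t \<le> pi" "1 \<le> a"
  shows "summable (\<lambda>j. (1 - cesaro_number a (int m - int (Suc j)) / cesaro_number a (int m)) *
            sin (real (Suc j) * t) / real (Suc j) powr q)"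
    and "0 \<le> (\<Sum>j. (1 - cesaro_number a (int m - int (Suc j)) / cesaro_number a (int m)) *
            sin (real (Suc j) * t) / real (Suc j) powr q)"
proof -
  define w where "w n = cesaro_number (a - 2) (int m - int n) / cesaro_number a (int m)" for n
  define v where "v n j = real (min (Suc j) (Suc n)) * sin (real (Suc j) * t) / real (Suc j) powr q" for n j
  \<comment> \<open>Here \<open>1 \<le> a\<close> enters: the numerator has order
    \<open>a - 2 \<ge> - 1\<close>.\<close>
  have w: "0 \<le> w n" for n
    using assms(4) cesaro_number_pos[of a "int m"] unfolding w_def
    by (intro divide_nonneg_nonneg cesaro_number_nonneg) auto
  have eq: "(1 - cesaro_number a (int m - int (Suc j)) / cesaro_number a (int m)) *
      sin (real (Suc j) * t) / real (Suc j) powr q = (\<Sum>n=0..m. w n * v n j)" for j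
    using assms(4) by (subst cesaro_defect_eq_sum)
      (auto simp: w_def v_def sum_distrib_right sum_divide_distrib mult.assoc simp del: of_nat_Suc min_Suc_Suc)
  have sums: "(\<lambda>j. \<Sum>n=0..m. w n * v n j) sums (\<Sum>n=0..m. w n * (\<Sum>j. v n j))"
    unfolding v_def by (intro sums_sum sums_mult summable_sums summable_min_sine assms)
  show "summable (\<lambda>j. (1 - cesaro_number a (int m - int (Suc j)) / cesaro_number a (int m)) *
            sin (real (Suc j) * t) / real (Suc j) powr q)"
    unfolding eq using sums by (rule sums_summable)
  have "0 \<le> (\<Sum>n=0..m. w n * (\<Sum>j. v n j))"
    unfolding v_def using assms by (intro sum_nonneg mult_nonneg_nonneg w min_sine_series_nonneg)
  then show "0 \<le> (\<Sum>j. (1 - cesaro_number a (int m - int (Suc j)) / cesaro_number a (int m)) *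
            sin (real (Suc j) * t) / real (Suc j) powr q)"
    unfolding eq using sums by (simp add: sums_iff)
qed

subsection \<open>Integration over a period\<close>

lemma finite_measure_period: "finite_measure period"
  by (rule finite_measure_lebesgue_on) simp

interpretation period: finite_measure period
  by (rule finite_measure_period)

interpretation period_pair: pair_sigma_finite period period ..

lemma measurable_ident_period: "(\<lambda>x. x) \<in> borel_measurable period"
  by (simp add: measurable_completion measurable_restrict_space1)

lemma borel_measurable_periodI: "f \<in> borel_measurable borel \<Longrightarrow> f \<in> borel_measurable period"
  by (rule measurable_compose[OF measurable_ident_period])

lemma measurable_fst_period: "fst \<in> borel_measurable (period \<Otimes>\<^sub>M period)"
  and measurable_snd_period: "snd \<in> borel_measurable (period \<Otimes>\<^sub>M period)"
  using measurable_compose[OF measurable_fst measurable_ident_period]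
    measurable_compose[OF measurable_snd measurable_ident_period] by auto

lemma nn_integral_period: "(\<integral>\<^sup>+x. f x \<partial>period) = (\<integral>\<^sup>+x. f x * indicator {-pi..pi} x \<partial>lborel)"
  by (simp add: nn_integral_restrict_space nn_integral_completion)

lemma AE_period_iff: "(AE x in period. Q x) \<longleftrightarrow> (AE x in lborel. x \<in> {-pi..pi} \<longrightarrow> Q x)"
  by (simp add: AE_restrict_space_iff AE_completion_iff)

section \<open>Translation and reflection of periodic functions\<close>

text \<open>The representative of \<open>t\<close> modulo \<open>2 * pi\<close> in the half-open
  interval from \<open>- pi\<close> to \<open>pi\<close>. A periodic function factors through it, so
  invariance of integrals can be expressed by image measures under \<open>wrap\<close>.\<close>

definition wrap :: "real \<Rightarrow> real"
  where "wrap t = t - of_int \<lfloor>(t + pi) / (2 * pi)\<rfloor> * (2 * pi)"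

lemma wrap_measurable [measurable]: "wrap \<in> borel_measurable borel"
  unfolding wrap_def by measurable

lemma wrap_add_period [simp]: "wrap (t + 2 * pi) = wrap t"
proof -
  have "(t + 2 * pi + pi) / (2 * pi) = (t + pi) / (2 * pi) + 1" by (simp add: field_simps)
  then show ?thesis by (simp add: wrap_def algebra_simps)
qed

lemma wrap_bounds: "- pi \<le> wrap t" "wrap t < pi"
proof -
  have "of_int \<lfloor>(t + pi) / (2 * pi)\<rfloor> \<le> (t + pi) / (2 * pi)" "(t + pi) / (2 * pi) < of_int \<lfloor>(t + pi) / (2 * pi)\<rfloor> + 1"
    by linarith+
  then have "of_int \<lfloor>(t + pi) / (2 * pi)\<rfloor> * (2 * pi) \<le> t + pi" "t + pi < (of_int \<lfloor>(t + pi) / (2 * pi)\<rfloor> + 1) * (2 * pi)"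
    using pi_gt_zero by (simp_all only: pos_le_divide_eq pos_divide_less_eq zero_less_mult_iff zero_less_numeral simp_thms)
  then show "- pi \<le> wrap t" "wrap t < pi"
    by (simp_all add: wrap_def algebra_simps)
qed

lemma periodic_of_int:
  assumes "\<And>t. f (t + 2 * pi) = f t"
  shows "f (t - of_int k * (2 * pi)) = f (t :: real)"
proof -
  interpret periodic_fun_simple f "2 * pi" by standard (rule assms)
  show ?thesis by (rule minus_of_int)
qed

lemma periodic_wrap:
  assumes "\<And>t. f (t + 2 * pi) = f t"
  shows "f (wrap t) = f t"
  unfolding wrap_def by (rule periodic_of_int[where f = f, OF assms])

text \<open>The reflection turns the window \<open>{-pi..pi}\<close> into
  \<open>{a - pi..a + pi}\<close>; the part beyond \<open>pi\<close> is moved back by one period.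
  This cut presupposes \<open>0 \<le> a < 2 * pi\<close>, to which periodicity reduces the general
  case.\<close>

lemma nn_integral_period_reflect:
  fixes f :: "real \<Rightarrow> ennreal"
  assumes [measurable]: "f \<in> borel_measurable borel" and per: "\<And>t. f (t + 2 * pi) = f t"
  shows "(\<integral>\<^sup>+t. f (a - t) \<partial>period) = (\<integral>\<^sup>+t. f t \<partial>period)"
proof -
  have shift: "(\<integral>\<^sup>+t. f (a - t) \<partial>period) = (\<integral>\<^sup>+t. f t \<partial>period)" if "0 \<le> a" "a < 2 * pi" for a
  proof -
    have split: "(\<integral>\<^sup>+t. f t * indicator {u..w} t \<partial>lborel)
        = (\<integral>\<^sup>+t. f t * indicator {u..v} t \<partial>lborel) + (\<integral>\<^sup>+t. f t * indicator {v..w} t \<partial>lborel)"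
      if "u \<le> v" "v \<le> w" for u v w
    proof -
      have "(\<integral>\<^sup>+t. f t * indicator {u..w} t \<partial>lborel)
          = (\<integral>\<^sup>+t. f t * indicator {u..v} t + f t * indicator {v..w} t \<partial>lborel)"
        using AE_lborel_singleton[of v] that
        by (intro nn_integral_cong_AE) (auto split: split_indicator elim!: eventually_mono)
      then show ?thesis by (simp add: nn_integral_add)
    qed
    have "(\<integral>\<^sup>+t. f (a - t) \<partial>period) = (\<integral>\<^sup>+t. f t * indicator {a - pi..a + pi} t \<partial>lborel)"
      unfolding nn_integral_period
      by (subst (2) nn_integral_real_affine[where c = "-1" and t = a])
        (auto intro!: nn_integral_cong split: split_indicator)
    also have "\<dots> = (\<integral>\<^sup>+t. f t * indicator {a - pi..pi} t \<partial>lborel) +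
        (\<integral>\<^sup>+t. f t * indicator {pi..a + pi} t \<partial>lborel)"
      using that by (intro split) auto
    also have "(\<integral>\<^sup>+t. f t * indicator {pi..a + pi} t \<partial>lborel) = (\<integral>\<^sup>+t. f t * indicator {-pi..a - pi} t \<partial>lborel)"
      by (subst nn_integral_real_affine[where c = 1 and t = "2 * pi"])
        (auto simp: per add.commute[of "2 * pi"] intro!: nn_integral_cong split: split_indicator)
    also have "(\<integral>\<^sup>+t. f t * indicator {a - pi..pi} t \<partial>lborel) + (\<integral>\<^sup>+t. f t * indicator {-pi..a - pi} t \<partial>lborel)
        = (\<integral>\<^sup>+t. f t \<partial>period)"
      unfolding nn_integral_period using that by (subst add.commute, intro split[symmetric]) auto
    finally show ?thesis .
  qed
  \<comment> \<open>\<open>wrap\<close> is centred at 0; conjugating it with a shift by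
    \<open>pi\<close> gives the residue of \<open>a\<close> between 0 and
    \<open>2 * pi\<close>.\<close>
  define b where "b = wrap (a - pi) + pi"
  have "f (a - t) = f (b - t)" for t
    using periodic_of_int[of f "a - t" "\<lfloor>(a - pi + pi) / (2 * pi)\<rfloor>", OF per]
    by (simp add: b_def wrap_def algebra_simps)
  moreover have "0 \<le> b" "b < 2 * pi"
    using wrap_bounds[of "a - pi"] by (auto simp: b_def)
  ultimately show ?thesis using shift[of b] by simp
qed

text \<open>A translation is the composite of two reflections.\<close>

lemma nn_integral_period_shift:
  fixes f :: "real \<Rightarrow> ennreal"
  assumes [measurable]: "f \<in> borel_measurable borel" and per: "\<And>t. f (t + 2 * pi) = f t"
  shows "(\<integral>\<^sup>+t. f (t + a) \<partial>period) = (\<integral>\<^sup>+t. f t \<partial>period)"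
proof -
  have "f (- (t + 2 * pi)) = f (- t)" for t
    using per[of "- (t + 2 * pi)"] by simp
  then have "(\<integral>\<^sup>+t. f (- ((- a) - t)) \<partial>period) = (\<integral>\<^sup>+t. f (- t) \<partial>period)"
    by (intro nn_integral_period_reflect) auto
  also have "\<dots> = (\<integral>\<^sup>+t. f (0 - t) \<partial>period)" by simp
  also have "\<dots> = (\<integral>\<^sup>+t. f t \<partial>period)"
    by (rule nn_integral_period_reflect) (auto simp: per)
  finally show ?thesis by (simp add: add.commute)
qed

text \<open>Equality of the image measures carries the invariance from nonnegative integrals over to
  Bochner integrals and to integrability.\<close>

lemma distr_wrap_reflect: "distr period borel (\<lambda>t. wrap (a - t)) = distr period borel wrap"
proof (rule measure_eqI)
  fix A assume "A \<in> sets (distr period borel (\<lambda>t. wrap (a - t)))"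
  then have [measurable]: "A \<in> sets borel" by simp
  have [measurable]: "(\<lambda>t. wrap (a - t)) \<in> borel_measurable period" "wrap \<in> borel_measurable period"
    by (rule borel_measurable_periodI, measurable)+
  have "emeasure (distr period borel (\<lambda>t. wrap (a - t))) A = (\<integral>\<^sup>+t. indicator A (wrap (a - t)) \<partial>period)"
    by (simp add: nn_integral_distr flip: nn_integral_indicator)
  also have "\<dots> = (\<integral>\<^sup>+t. indicator A (wrap t) \<partial>period)"
    by (rule nn_integral_period_reflect[where f = "\<lambda>t. indicator A (wrap t)"])
      (simp_all add: measurable_compose[OF wrap_measurable borel_measurable_indicator])
  also have "\<dots> = emeasure (distr period borel wrap) A"
    by (simp add: nn_integral_distr flip: nn_integral_indicator)
  finally show "emeasure (distr period borel (\<lambda>t. wrap (a - t))) A = emeasure (distr period borel wrap) A" .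
qed simp

lemma
  fixes f :: "real \<Rightarrow> real"
  assumes f: "f \<in> borel_measurable borel" and per: "\<And>t. f (t + 2 * pi) = f t"
  shows integral_period_reflect: "(LINT t|period. f (a - t)) = (LINT t|period. f t)"
    and integrable_period_reflect_iff: "integrable period (\<lambda>t. f (a - t)) \<longleftrightarrow> integrable period f"
proof -
  have 1: "(\<lambda>t. wrap (a - t)) \<in> borel_measurable period" "wrap \<in> borel_measurable period"
    by (rule borel_measurable_periodI, measurable)+
  note w = periodic_wrap[of f, OF per]
  show "(LINT t|period. f (a - t)) = (LINT t|period. f t)"
    using integral_distr[OF 1(1) f] integral_distr[OF 1(2) f] by (simp add: distr_wrap_reflect w)
  show "integrable period (\<lambda>t. f (a - t)) \<longleftrightarrow> integrable period f"
    using integrable_distr_eq[OF 1(1) f] integrable_distr_eq[OF 1(2) f] by (simp add: distr_wrap_reflect w)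
qed

lemma integral_period_shift:
  fixes f :: "real \<Rightarrow> real"
  assumes [measurable]: "f \<in> borel_measurable borel" and per: "\<And>t. f (t + 2 * pi) = f t"
  shows "(LINT t|period. f (t + a)) = (LINT t|period. f t)"
proof -
  have "f (- (t + 2 * pi)) = f (- t)" for t
    using per[of "- (t + 2 * pi)"] by simp
  then have "(LINT t|period. f (- ((- a) - t))) = (LINT t|period. f (- t))"
    by (intro integral_period_reflect) auto
  also have "\<dots> = (LINT t|period. f (0 - t))" by simp
  also have "\<dots> = (LINT t|period. f t)"
    by (rule integral_period_reflect) (auto simp: per)
  finally show ?thesis by (simp add: add.commute)
qed

lemma AE_period_reflect:
  assumes [measurable]: "Measurable.pred borel Q" and per: "\<And>t. Q (t + 2 * pi) = Q t"
    and "AE t in period. Q t"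
  shows "AE t in period. Q (a - t)"
proof -
  have [measurable]: "(\<lambda>t. indicator {s. \<not> Q s} t :: ennreal) \<in> borel_measurable period"
    "(\<lambda>t. indicator {s. \<not> Q s} (a - t) :: ennreal) \<in> borel_measurable period"
    by (rule borel_measurable_periodI, measurable)+
  have "(\<integral>\<^sup>+t. indicator {s. \<not> Q s} (a - t) \<partial>period) = (\<integral>\<^sup>+t. indicator {s. \<not> Q s} t \<partial>period)"
    by (rule nn_integral_period_reflect) (auto simp: indicator_def per)
  also have "\<dots> = 0"
    using assms(3) by (subst nn_integral_0_iff_AE) (auto elim!: eventually_mono)
  finally have "AE t in period. indicator {s. \<not> Q s} (a - t) = (0 :: ennreal)"
    by (rule nn_integral_0_iff_AE[THEN iffD1, rotated]) measurable
  then show ?thesis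
    by (auto elim!: eventually_mono simp: indicator_def split: if_splits)
qed

text \<open>If \<open>h\<close> is a Borel version of \<open>f\<close> off a null set
  \<open>N\<close>, then \<open>h (wrap t)\<close> is periodic and can differ from
  \<open>f t\<close> only if \<open>wrap t\<close> lies in \<open>N\<close>, that is, on countably
  many translates of \<open>N\<close>. Borel measurability is wanted because it survives the
  composition with \<open>x - t\<close> on the product space, as Fubini requires.\<close>

lemma periodic_borel_version:
  fixes f :: "real \<Rightarrow> real"
  assumes "f \<in> borel_measurable lebesgue" and per: "\<And>t. f (t + 2 * pi) = f t"
  obtains g where "g \<in> borel_measurable borel" "\<And>t. g (t + 2 * pi) = g t"
    "AE t in lborel. f t = g t"
proof -
  obtain h where [measurable]: "h \<in> borel_measurable borel" and "AE t in lborel. f t = h t"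
    using completion_ex_borel_measurable_real[OF assms(1)] by auto
  then obtain N where N: "N \<in> null_sets lborel" "{t. f t \<noteq> h t} \<subseteq> N"
    unfolding eventually_ae_filter by auto
  then have [measurable]: "N \<in> sets borel" and "AE t in lborel. t \<notin> N"
    by (auto intro: AE_not_in)
  then have "AE t in lborel. t - of_int k * (2 * pi) \<notin> N" for k :: int
    using AE_borel_affine[of 1 "\<lambda>t. t \<notin> N" "- of_int k * (2 * pi)"] by simp
  then have "AE t in lborel. \<forall>k::int. t - of_int k * (2 * pi) \<notin> N"
    unfolding AE_all_countable by blast
  then have "AE t in lborel. f t = h (wrap t)"
  proof eventually_elim
    case (elim t)
    then have "wrap t \<notin> N" by (simp add: wrap_def)
    then have "f (wrap t) = h (wrap t)" using N(2) by blast
    then show ?case using periodic_wrap[of f t, OF per] by simp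
  qed
  then show ?thesis
    by (intro that[of "\<lambda>t. h (wrap t)"]) auto
qed

text \<open>The reflection about \<open>x\<close> preserves null sets. Since this holds for every
  \<open>x\<close>, a function and its Borel version have the same convolution as functions, not
  just almost everywhere.\<close>

lemma integral_period_conv_cong:
  fixes f g k :: "real \<Rightarrow> real"
  assumes f: "f \<in> borel_measurable lebesgue" and [measurable]: "g \<in> borel_measurable borel" "k \<in> borel_measurable borel"
    and eq: "AE t in lborel. f t = g t"
  shows "(LINT t|period. f (x - t) * k t) = (LINT t|period. g (x - t) * k t)"
proof (rule Bochner_Integration.integral_cong_AE)
  have "(\<lambda>t. f (x - t)) \<in> borel_measurable lebesgue"
    using measurable_compose[OF lebesgue_affine_measurable[of "\<lambda>_. -1" x] f] by simp
  then have [measurable]: "(\<lambda>t. f (x - t)) \<in> borel_measurable period"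
    by (rule measurable_restrict_space1)
  have [measurable]: "k \<in> borel_measurable period"
    by (rule borel_measurable_periodI) measurable
  show "(\<lambda>t. f (x - t) * k t) \<in> borel_measurable period"
    by measurable
  show "(\<lambda>t. g (x - t) * k t) \<in> borel_measurable period"
    by (rule borel_measurable_periodI) measurable
  obtain N where N: "N \<in> null_sets lborel" "{t. f t \<noteq> g t} \<subseteq> N"
    using eq unfolding eventually_ae_filter by auto
  then have [measurable]: "N \<in> sets borel" and "AE t in lborel. t \<notin> N"
    by (auto intro: AE_not_in)
  then have "AE t in lborel. x - t \<notin> N"
    using AE_borel_affine[of "-1" "\<lambda>t. t \<notin> N" x] by simp
  then show "AE t in period. f (x - t) * k t = g (x - t) * k t"
    unfolding AE_period_iff using N(2) by (auto elim!: eventually_mono)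
qed

subsection \<open>Convolution with a kernel of prescribed sign\<close>

lemma integrable_period_mult_bounded:
  fixes f g :: "real \<Rightarrow> real"
  assumes "integrable period f" "g \<in> borel_measurable borel" "\<And>t. \<bar>g t\<bar> \<le> B"
  shows "integrable period (\<lambda>t. f t * g t)"
proof (rule Bochner_Integration.integrable_bound)
  show "integrable period (\<lambda>t. B * f t)" using assms(1) by simp
  have [measurable]: "g \<in> borel_measurable period" "f \<in> borel_measurable period"
    using borel_measurable_periodI[OF assms(2)] assms(1) by auto
  show "(\<lambda>t. f t * g t) \<in> borel_measurable period" by measurable
  have "\<bar>f t\<bar> * \<bar>g t\<bar> \<le> \<bar>B\<bar> * \<bar>f t\<bar>" for t
    using mult_left_mono[OF order_trans[OF assms(3)[of t] abs_ge_self] abs_ge_zero[of "f t"]]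
    by (simp add: mult.commute)
  then show "AE t in period. norm (f t * g t) \<le> norm (B * f t)"
    by (simp add: abs_mult)
qed

lemma integrable_period_bounded:
  fixes g :: "real \<Rightarrow> real"
  assumes "g \<in> borel_measurable borel" "\<And>t. \<bar>g t\<bar> \<le> B"
  shows "integrable period g"
  using integrable_period_mult_bounded[of "\<lambda>_. 1" g B] assms by simp

lemma integrable_period_pair_bounded:
  fixes g :: "real \<times> real \<Rightarrow> real"
  assumes "g \<in> borel_measurable (period \<Otimes>\<^sub>M period)" "\<And>p. \<bar>g p\<bar> \<le> B"
  shows "integrable (period \<Otimes>\<^sub>M period) g"
  by (rule finite_measure.integrable_const_bound[of _ _ B])
    (auto simp: assms intro!: finite_measure_pair_measure finite_measure_period)

lemma AE_period_exists:
  assumes "AE x in period. Q x" "0 < e" "e \<le> pi"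
  shows "\<exists>x. \<bar>x\<bar> \<le> e \<and> Q x"
proof (rule ccontr)
  assume "\<not> ?thesis"
  then have "AE x in lborel. x \<notin> {-e..e}"
    using assms(1,3) unfolding AE_period_iff by (auto elim!: eventually_mono simp: abs_le_iff)
  then have "{-e..e} \<in> null_sets lborel"
    by (simp add: AE_iff_null_sets)
  then show False using assms(2) by (simp add: null_sets_def)
qed

lemma Lp_norm_1: "Lp_norm 1 f = (\<integral>\<^sup>+t. ennreal \<bar>f t\<bar> \<partial>period)"
  by (simp add: Lp_norm_def Let_def ennreal_enn2real_if)

lemma Lp_norm_infinity: "Lp_norm \<infinity> f = esssup period (\<lambda>t. ennreal \<bar>f t\<bar>)"
  by (simp add: Lp_norm_def)

lemma fourier_coeff_0: "fourier_coeff f 0 = complex_of_real (1 / (2 * pi) * (LINT t|period. f t))"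
  by (simp add: fourier_coeff_def)

lemma Lp_norm_le_1_imp:
  assumes "p = 1 \<or> p = \<infinity>" "Lp_norm p f \<le> 1" "f \<in> borel_measurable borel"
  shows "integrable period f" and "p = 1 \<Longrightarrow> (\<integral>\<^sup>+t. ennreal \<bar>f t\<bar> \<partial>period) \<le> 1"
    and "p = \<infinity> \<Longrightarrow> AE t in period. \<bar>f t\<bar> \<le> 1"
proof -
  have [measurable]: "f \<in> borel_measurable period"
    using assms(3) by (rule borel_measurable_periodI)
  show *: "(\<integral>\<^sup>+t. ennreal \<bar>f t\<bar> \<partial>period) \<le> 1" if "p = 1"
    using assms(2) that by (simp add: Lp_norm_1)
  show **: "AE t in period. \<bar>f t\<bar> \<le> 1" if "p = \<infinity>"
    using esssup_AE[of "\<lambda>t. ennreal \<bar>f t\<bar>" period]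
  proof eventually_elim
    case (elim t)
    also have "esssup period (\<lambda>t. ennreal \<bar>f t\<bar>) \<le> 1"
      using assms(2) unfolding that Lp_norm_infinity .
    finally show ?case by simp
  qed
  show "integrable period f"
  proof (cases "p = 1")
    case True
    then show ?thesis using *
      by (intro integrableI_bounded) (auto intro: order.strict_trans1[of _ 1])
  next
    case False
    then have "AE t in period. norm (f t) \<le> 1" using ** assms(1) by simp
    then show ?thesis by (intro period.integrable_const_bound) auto
  qed
qed

lemma H1_borel_version:
  assumes p: "p = 1 \<or> p = \<infinity>" and f: "f \<in> H1 p"
  obtains g where "g \<in> borel_measurable borel" "\<And>t. g (t + 2 * pi) = g t"
    "AE t in lborel. f t = g t" "integrable period g" "(LINT t|period. g t) = 0" "Lp_norm p g \<le> 1"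
proof -
  have fm: "f \<in> borel_measurable lebesgue" and per: "\<And>t. f (t + 2 * pi) = f t"
    and le: "Lp_norm p f \<le> 1" and f0: "fourier_coeff f 0 = 0"
    using f by (auto simp: H1_def Lp_space_def)
  obtain g where g: "g \<in> borel_measurable borel" "\<And>t. g (t + 2 * pi) = g t" "AE t in lborel. f t = g t"
    using periodic_borel_version[OF fm per] by blast
  have ae: "AE t in period. f t = g t"
    unfolding AE_period_iff using g(3) by eventually_elim simp
  have [measurable]: "f \<in> borel_measurable period" "g \<in> borel_measurable period"
    using measurable_restrict_space1[OF fm] borel_measurable_periodI[OF g(1)] by auto
  have "Lp_norm p g = Lp_norm p f"
  proof (cases "p = 1")
    case True
    then show ?thesis
      using ae by (auto simp: Lp_norm_1 intro!: nn_integral_cong_AE elim!: eventually_mono)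
  next
    case False
    then have inf: "p = \<infinity>" using p by simp
    show ?thesis
      unfolding inf Lp_norm_infinity using ae by (intro esssup_AE_cong) (auto elim!: eventually_mono)
  qed
  with le have le': "Lp_norm p g \<le> 1" by simp
  have "(LINT t|period. g t) = (LINT t|period. f t)"
    using ae by (intro Bochner_Integration.integral_cong_AE) (auto elim!: eventually_mono)
  also have "\<dots> = 0"
    using f0 unfolding fourier_coeff_0 of_real_eq_0_iff by simp
  finally show ?thesis
    using that g Lp_norm_le_1_imp(1)[OF p le' g(1)] le' by blast
qed

lemma H1_I:
  assumes "g \<in> borel_measurable borel" "\<And>t. g (t + 2 * pi) = g t"
    "(LINT t|period. g t) = 0" "Lp_norm p g \<le> 1"
  shows "g \<in> H1 p"
  using assms by (auto simp: H1_def Lp_space_def fourier_coeff_0 measurable_completion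
      intro: order.strict_trans1[of _ 1])

text \<open>The constant \<open>c\<close> may be subtracted from the kernel because the convolved functions
  have mean zero; \<open>s\<close> is then the extremal function of the resulting \<open>L\<^sub>1\<close> norm.\<close>

locale signed_kernel =
  fixes K s :: "real \<Rightarrow> real" and c B :: real
  assumes K_measurable [measurable]: "K \<in> borel_measurable borel"
    and s_measurable [measurable]: "s \<in> borel_measurable borel"
    and K_bound: "\<And>t. \<bar>K t\<bar> \<le> B"
    and s_bound: "\<And>t. \<bar>s t\<bar> \<le> 1"
    and s_shift: "\<And>t. s (t + pi) = - s t"
    and s_cont: "AE t in period. isCont s t"
    and sign: "\<And>t. t \<in> {-pi..pi} \<Longrightarrow> (K t - c) * s t = \<bar>K t - c\<bar>"
begin

definition conv :: "(real \<Rightarrow> real) \<Rightarrow> real \<Rightarrow> real"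
  where "conv \<phi> x = 1 / (2 * pi) * (LINT t|period. \<phi> (x - t) * K t)"

definition E :: real
  where "E = 1 / (2 * pi) * (LINT t|period. K t * s t)"

text \<open>The correlation of \<open>s\<close> with \<open>K\<close>, the common source of both
  lower bounds: pairing \<open>conv \<phi>\<close> with \<open>s\<close> equals pairing
  \<open>\<phi>\<close> with \<open>H\<close>, and \<open>conv\<close> of the reflected
  \<open>s\<close> is \<open>H (- x)\<close>. The value at 0 is \<open>E\<close>.\<close>

definition H :: "real \<Rightarrow> real"
  where "H u = 1 / (2 * pi) * (LINT t|period. s (u + t) * K t)"

lemma K_minus_bound: "\<bar>K t - c\<bar> \<le> B + \<bar>c\<bar>"
  using K_bound[of t] by linarith

lemma s_period: "s (t + 2 * pi) = s t"
  using s_shift[of t] s_shift[of "t + pi"] by (simp add: algebra_simps)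

lemma integrable_sK: "integrable period (\<lambda>t. s (u + t) * K t)"
  using s_bound by (intro integrable_period_mult_bounded[OF _ _ K_bound] integrable_period_bounded) auto

lemma integrable_K_minus: "integrable period (\<lambda>t. \<bar>K t - c\<bar>)"
  using K_minus_bound by (intro integrable_period_bounded[where B = "B + \<bar>c\<bar>"]) auto

text \<open>The shift by \<open>pi\<close> negates \<open>s\<close>, so \<open>s\<close> has mean
  zero and \<open>c\<close> drops out of the integral of \<open>(K - c) * s\<close>.\<close>

lemma E_eq: "E = 1 / (2 * pi) * (LINT t|period. \<bar>K t - c\<bar>)"
proof -
  have s: "integrable period s"
    using s_bound by (intro integrable_period_bounded) auto
  have "(LINT t|period. s t) = (LINT t|period. s (t + pi))"
    by (rule integral_period_shift[symmetric]) (auto simp: s_period)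
  then have s0: "(LINT t|period. s t) = 0"
    by (simp add: s_shift)
  have "(LINT t|period. \<bar>K t - c\<bar>) = (LINT t|period. s (0 + t) * K t - c * s t)"
    by (rule Bochner_Integration.integral_cong) (auto simp flip: sign simp: algebra_simps)
  also have "\<dots> = (LINT t|period. s (0 + t) * K t)"
    using s0 s by (subst Bochner_Integration.integral_diff[OF integrable_sK]) auto
  finally show ?thesis by (simp add: E_def mult.commute)
qed

lemma E_nonneg: "0 \<le> E"
  unfolding E_eq by (intro mult_nonneg_nonneg integral_nonneg_AE) auto

lemma nn_integral_K_minus: "(\<integral>\<^sup>+t. ennreal (1 / (2 * pi) * \<bar>K t - c\<bar>) \<partial>period) = ennreal E"
  unfolding E_eq using integrable_K_minus
  by (subst nn_integral_eq_integral) auto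

lemma H_0: "H 0 = E"
  by (simp add: H_def E_def mult.commute)

lemma H_shift: "H (u + pi) = - H u"
proof -
  have "s (u + pi + t) = - s (u + t)" for t
    using s_shift[of "u + t"] by (simp add: algebra_simps)
  then show ?thesis by (simp add: H_def)
qed

lemma H_period: "H (u + 2 * pi) = H u"
  using H_shift[of u] H_shift[of "u + pi"] by (simp add: algebra_simps)

lemma sK_le: "\<bar>s u * K t\<bar> \<le> B"
  using mult_mono[OF s_bound[of u] K_bound[of t]] by (simp add: abs_mult)

text \<open>Although \<open>s\<close> may jump, it is continuous at almost every \<open>t\<close>,
  which suffices for dominated convergence with the constant \<open>B\<close>.\<close>

lemma H_cont: "isCont H 0"
proof -
  have "(\<lambda>n. LINT t|period. s (u n + t) * K t) \<longlonglongrightarrow> (LINT t|period. s (0 + t) * K t)"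
    if u: "u \<longlonglongrightarrow> 0" for u
  proof (rule integral_dominated_convergence)
    show "integrable period (\<lambda>_. B)" by simp
    show "(\<lambda>t. s (0 + t) * K t) \<in> borel_measurable period"
      "(\<lambda>t. s (u n + t) * K t) \<in> borel_measurable period" for n
      by (rule borel_measurable_periodI, measurable)+
    show "AE t in period. norm (s (u n + t) * K t) \<le> B" for n
      using sK_le by simp
    show "AE t in period. (\<lambda>n. s (u n + t) * K t) \<longlonglongrightarrow> s (0 + t) * K t"
      using s_cont
    proof eventually_elim
      case (elim t)
      have "(\<lambda>n. u n + t) \<longlonglongrightarrow> 0 + t" using u by (intro tendsto_intros)
      then show ?case using elim by (intro tendsto_mult tendsto_const isCont_tendsto_compose[of _ s]) auto
    qed
  qed
  then show ?thesis
    unfolding H_def by (intro continuous_at_sequentiallyI tendsto_mult tendsto_const) auto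
qed

lemma H_measurable [measurable]: "H \<in> borel_measurable borel"
proof -
  note [measurable] = measurable_ident_period
  have "K \<in> borel_measurable period"
    by (rule borel_measurable_periodI) measurable
  then show ?thesis
    unfolding H_def by measurable
qed

lemma H_bound: "\<bar>H u\<bar> \<le> B"
proof -
  have "\<bar>LINT t|period. s (u + t) * K t\<bar> \<le> (LINT t|period. \<bar>s (u + t) * K t\<bar>)"
    by simp
  also have "\<dots> \<le> (LINT t|period. B)"
    using integrable_sK sK_le by (intro integral_mono) auto
  also have "\<dots> = 2 * pi * B"
    by (simp add: measure_restrict_space)
  finally show ?thesis
    by (simp add: H_def abs_mult field_simps)
qed

text \<open>The neighbourhood of 0 is expressed as \<open>cos e < cos u\<close> to make it periodic;
  its translate by \<open>pi\<close> is then simply \<open>cos u < - cos e\<close>.\<close>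

lemma H_near_E:
  assumes "0 < d"
  obtains e where "0 < e" "e \<le> pi / 2" "\<And>u. cos e < cos u \<Longrightarrow> E - d \<le> H u"
proof -
  obtain e0 where e0: "0 < e0" "\<And>u. \<bar>u\<bar> < e0 \<Longrightarrow> \<bar>H u - E\<bar> < d"
    using H_cont assms unfolding continuous_at_eps_delta H_0 dist_real_def by auto
  define e where "e = min e0 (pi / 2)"
  have e: "0 < e" "e \<le> pi / 2" using e0(1) by (auto simp: e_def)
  have "E - d \<le> H u" if "cos e < cos u" for u
  proof -
    have "\<bar>wrap u\<bar> < e"
    proof (rule ccontr)
      assume "\<not> ?thesis"
      then have "cos \<bar>wrap u\<bar> \<le> cos e"
        using e wrap_bounds[of u] by (intro cos_monotone_0_pi_le) auto
      then show False using that periodic_wrap[of cos u] by simp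
    qed
    then have "\<bar>H (wrap u) - E\<bar> < d" by (intro e0) (auto simp: e_def)
    then show ?thesis using periodic_wrap[of H u, OF H_period] by linarith
  qed
  then show ?thesis using that e by blast
qed

lemma conv_eq:
  assumes [measurable]: "\<phi> \<in> borel_measurable borel" and "\<And>t. \<phi> (t + 2 * pi) = \<phi> t"
    and "integrable period \<phi>" "(LINT t|period. \<phi> t) = 0"
  shows "conv \<phi> x = (LINT t|period. \<phi> (x - t) * (1 / (2 * pi) * (K t - c)))"
    and "integrable period (\<lambda>t. \<phi> (x - t) * (1 / (2 * pi) * (K t - c)))"
proof -
  have 1: "integrable period (\<lambda>t. \<phi> (x - t))" "(LINT t|period. \<phi> (x - t)) = 0"
    using assms by (simp_all add: integrable_period_reflect_iff integral_period_reflect)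
  have 2: "integrable period (\<lambda>t. \<phi> (x - t) * K t)"
    using 1(1) by (rule integrable_period_mult_bounded[OF _ _ K_bound]) measurable
  have "(LINT t|period. \<phi> (x - t) * (1 / (2 * pi) * (K t - c)))
      = (LINT t|period. 1 / (2 * pi) * (\<phi> (x - t) * K t - c * \<phi> (x - t)))"
    by (intro Bochner_Integration.integral_cong) (auto simp: field_simps)
  also have "\<dots> = 1 / (2 * pi) * ((LINT t|period. \<phi> (x - t) * K t) - c * (LINT t|period. \<phi> (x - t)))"
    using 1 2 by simp
  finally show "conv \<phi> x = (LINT t|period. \<phi> (x - t) * (1 / (2 * pi) * (K t - c)))"
    unfolding conv_def 1(2) by simp
  show "integrable period (\<lambda>t. \<phi> (x - t) * (1 / (2 * pi) * (K t - c)))"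
  proof (rule integrable_period_mult_bounded[OF 1(1)])
    show "\<bar>1 / (2 * pi) * (K t - c)\<bar> \<le> 1 / (2 * pi) * (B + \<bar>c\<bar>)" for t
      unfolding abs_mult using K_minus_bound[of t] by (intro mult_mono) auto
  qed measurable
qed

lemma conv_measurable:
  assumes [measurable]: "\<phi> \<in> borel_measurable borel"
  shows "conv \<phi> \<in> borel_measurable borel"
proof -
  note [measurable] = measurable_ident_period
  have "K \<in> borel_measurable period"
    by (rule borel_measurable_periodI) measurable
  then show ?thesis
    unfolding conv_def by measurable
qed

lemma conv_le_sup:
  assumes \<phi>: "\<phi> \<in> borel_measurable borel" "\<And>t. \<phi> (t + 2 * pi) = \<phi> t"
    "integrable period \<phi>" "(LINT t|period. \<phi> t) = 0" and le: "AE t in period. \<bar>\<phi> t\<bar> \<le> 1"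
  shows "\<bar>conv \<phi> x\<bar> \<le> E"
proof -
  note [measurable] = \<phi>(1)
  have ae: "AE t in period. \<bar>\<phi> (x - t)\<bar> \<le> 1"
    by (rule AE_period_reflect[where Q = "\<lambda>t. \<bar>\<phi> t\<bar> \<le> 1"]) (use \<phi> le in auto)
  have "\<bar>conv \<phi> x\<bar> \<le> (LINT t|period. \<bar>\<phi> (x - t) * (1 / (2 * pi) * (K t - c))\<bar>)"
    unfolding conv_eq(1)[OF \<phi>] by (rule integral_abs_bound)
  also have "\<dots> \<le> (LINT t|period. 1 / (2 * pi) * \<bar>K t - c\<bar>)"
  proof (rule integral_mono_AE)
    show "AE t in period. \<bar>\<phi> (x - t) * (1 / (2 * pi) * (K t - c))\<bar> \<le> 1 / (2 * pi) * \<bar>K t - c\<bar>"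
      using ae
    proof eventually_elim
      case (elim t)
      have "\<bar>\<phi> (x - t)\<bar> * (1 / (2 * pi) * \<bar>K t - c\<bar>) \<le> 1 * (1 / (2 * pi) * \<bar>K t - c\<bar>)"
        using elim by (intro mult_right_mono) auto
      then show ?case by (simp add: abs_mult)
    qed
    show "integrable period (\<lambda>t. \<bar>\<phi> (x - t) * (1 / (2 * pi) * (K t - c))\<bar>)"
      by (intro integrable_abs conv_eq(2)[OF \<phi>])
  qed (use integrable_K_minus in simp)
  finally show ?thesis by (simp add: E_eq)
qed

text \<open>Young's inequality: by Tonelli and translation invariance the double integral factors
  into the two L1 norms.\<close>

lemma nn_integral_conv_le:
  assumes \<phi>: "\<phi> \<in> borel_measurable borel" "\<And>t. \<phi> (t + 2 * pi) = \<phi> t"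
    "integrable period \<phi>" "(LINT t|period. \<phi> t) = 0"
    and le: "(\<integral>\<^sup>+t. ennreal \<bar>\<phi> t\<bar> \<partial>period) \<le> 1"
  shows "(\<integral>\<^sup>+x. ennreal \<bar>conv \<phi> x\<bar> \<partial>period) \<le> ennreal E"
proof -
  note [measurable] = \<phi>(1) measurable_fst_period measurable_snd_period
  have "(\<integral>\<^sup>+x. ennreal \<bar>conv \<phi> x\<bar> \<partial>period)
      \<le> (\<integral>\<^sup>+x. \<integral>\<^sup>+t. ennreal (norm (\<phi> (x - t) * (1 / (2 * pi) * (K t - c)))) \<partial>period \<partial>period)"
    unfolding conv_eq(1)[OF \<phi>] real_norm_def[symmetric]
    by (intro nn_integral_mono integral_norm_bound_ennreal conv_eq(2)[OF \<phi>])
  also have "\<dots> = (\<integral>\<^sup>+t. \<integral>\<^sup>+x. ennreal (norm (\<phi> (x - t) * (1 / (2 * pi) * (K t - c)))) \<partial>period \<partial>period)"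
    by (rule period_pair.Fubini'[symmetric]) measurable
  also have "\<dots> = (\<integral>\<^sup>+t. ennreal (1 / (2 * pi) * \<bar>K t - c\<bar>) * (\<integral>\<^sup>+x. ennreal \<bar>\<phi> x\<bar> \<partial>period) \<partial>period)"
  proof (rule nn_integral_cong)
    fix t
    have [measurable]: "(\<lambda>x. ennreal \<bar>\<phi> (x + - t)\<bar>) \<in> borel_measurable period"
      by (rule borel_measurable_periodI) measurable
    have "(\<integral>\<^sup>+x. ennreal (norm (\<phi> (x - t) * (1 / (2 * pi) * (K t - c)))) \<partial>period)
        = (\<integral>\<^sup>+x. ennreal (1 / (2 * pi) * \<bar>K t - c\<bar>) * ennreal \<bar>\<phi> (x + - t)\<bar> \<partial>period)"
      by (intro nn_integral_cong) (simp add: abs_mult mult.commute flip: ennreal_mult)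
    also have "\<dots> = ennreal (1 / (2 * pi) * \<bar>K t - c\<bar>) * (\<integral>\<^sup>+x. ennreal \<bar>\<phi> (x + - t)\<bar> \<partial>period)"
      by (rule nn_integral_cmult) measurable
    also have "(\<integral>\<^sup>+x. ennreal \<bar>\<phi> (x + - t)\<bar> \<partial>period) = (\<integral>\<^sup>+x. ennreal \<bar>\<phi> x\<bar> \<partial>period)"
      by (rule nn_integral_period_shift) (auto simp: \<phi>(2))
    finally show "(\<integral>\<^sup>+x. ennreal (norm (\<phi> (x - t) * (1 / (2 * pi) * (K t - c)))) \<partial>period)
        = ennreal (1 / (2 * pi) * \<bar>K t - c\<bar>) * (\<integral>\<^sup>+x. ennreal \<bar>\<phi> x\<bar> \<partial>period)" .
  qed
  also have "\<dots> \<le> (\<integral>\<^sup>+t. ennreal (1 / (2 * pi) * \<bar>K t - c\<bar>) * 1 \<partial>period)"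
    by (intro nn_integral_mono mult_left_mono le) auto
  also have "\<dots> = ennreal E"
    using nn_integral_K_minus by simp
  finally show ?thesis .
qed

text \<open>The adjoint of \<open>conv\<close> applied to \<open>s\<close>: Fubini, the substitution
  \<open>u = x - t\<close> over a period, and Fubini back. The bound \<open>C\<close> secures
  integrability on the square.\<close>

lemma integral_conv_s:
  assumes [measurable]: "\<phi> \<in> borel_measurable borel" and "\<And>t. \<phi> (t + 2 * pi) = \<phi> t"
    and "\<And>t. \<bar>\<phi> t\<bar> \<le> C"
  shows "(LINT x|period. conv \<phi> x * s x) = (LINT u|period. \<phi> u * H u)"
proof -
  note [measurable] = measurable_fst_period measurable_snd_period
  have le: "\<bar>\<phi> u * (s v * K t)\<bar> \<le> C * B" for u v t
    unfolding abs_mult[of "\<phi> u"] using assms(3)[of u] sK_le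
    by (intro mult_mono) (auto intro: order_trans[OF abs_ge_zero])
  have "(LINT x|period. conv \<phi> x * s x) = 1 / (2 * pi) * (LINT x|period. LINT t|period. \<phi> (x - t) * (s x * K t))"
    unfolding conv_def by (simp add: mult.assoc mult.left_commute mult.commute flip: Bochner_Integration.integral_mult_right_zero Bochner_Integration.integral_mult_left_zero)
  also have "(LINT x|period. LINT t|period. \<phi> (x - t) * (s x * K t))
      = (LINT t|period. LINT x|period. \<phi> (x - t) * (s x * K t))"
    by (rule period_pair.Fubini_integral[symmetric], rule integrable_period_pair_bounded[where B = "C * B"])
      (measurable, simp add: le split_beta)
  also have "\<dots> = (LINT t|period. LINT u|period. \<phi> u * (s (u + t) * K t))"
  proof (rule Bochner_Integration.integral_cong[OF refl])
    fix t
    have "(LINT x|period. \<phi> (x + - t) * (s (x + - t + t) * K t)) = (LINT u|period. \<phi> u * (s (u + t) * K t))"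
      by (rule integral_period_shift[where f = "\<lambda>u. \<phi> u * (s (u + t) * K t)"])
        (measurable, use assms(2) s_period[of "u + t" for u] in \<open>simp add: algebra_simps\<close>)
    then show "(LINT x|period. \<phi> (x - t) * (s x * K t)) = (LINT u|period. \<phi> u * (s (u + t) * K t))"
      by simp
  qed
  also have "\<dots> = (LINT u|period. LINT t|period. \<phi> u * (s (u + t) * K t))"
    by (rule period_pair.Fubini_integral, rule integrable_period_pair_bounded[where B = "C * B"])
      (measurable, simp add: le split_beta)
  finally show ?thesis
    unfolding H_def by (simp add: mult.left_commute)
qed

text \<open>As \<open>\<bar>s\<bar> \<le> 1\<close>, the L1 norm of \<open>conv \<phi>\<close> is at
  least its pairing with \<open>s\<close>, which is the pairing of \<open>\<phi>\<close> with
  \<open>H\<close>. A single bump at 0 would violate the mean-zero condition; the opposite bump at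
  \<open>pi\<close> restores it without loss, since \<open>H (u + pi) = - H u\<close>.\<close>

lemma exists_near_extremal_L1:
  assumes "0 < d"
  obtains \<phi> where "\<phi> \<in> borel_measurable borel" "\<And>t. \<phi> (t + 2 * pi) = \<phi> t"
    "(LINT t|period. \<phi> t) = 0" "(\<integral>\<^sup>+t. ennreal \<bar>\<phi> t\<bar> \<partial>period) \<le> 1"
    "ennreal (E - d) \<le> (\<integral>\<^sup>+x. ennreal \<bar>conv \<phi> x\<bar> \<partial>period)"
proof -
  obtain e where e: "0 < e" "e \<le> pi / 2" and near: "\<And>u. cos e < cos u \<Longrightarrow> E - d \<le> H u"
    using H_near_E[OF assms] by blast
  \<comment> \<open>This keeps the two bumps disjoint.\<close>
  have cos_e: "0 \<le> cos e" using e by (intro cos_ge_zero) auto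
  define a where "a u = (if cos e < cos u then 1 else if cos u < - cos e then - 1 else 0 :: real)" for u
  define M where "M = (LINT u|period. \<bar>a u\<bar>)"
  have [measurable]: "a \<in> borel_measurable borel"
    unfolding a_def by measurable
  have a_le: "\<bar>a u\<bar> \<le> 1" for u by (simp add: a_def)
  have a_int: "integrable period a"
    using a_le by (intro integrable_period_bounded) auto
  have a_shift: "a (u + pi) = - a u" for u
    using cos_e by (auto simp: a_def)
  have a_per: "a (u + 2 * pi) = a u" for u
    by (simp add: a_def)
  have "(LINT u|period. a u) = (LINT u|period. a (u + pi))"
    by (rule integral_period_shift[symmetric]) (auto simp: a_per)
  then have a0: "(LINT u|period. a u) = 0"
    by (simp add: a_shift)
  have "M \<noteq> 0"
  proof
    assume "M = 0"
    then have "AE u in period. a u = 0"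
      unfolding M_def using a_int by (subst (asm) integral_nonneg_eq_0_iff_AE) auto
    then obtain u where "\<bar>u\<bar> \<le> e / 2" "a u = 0"
      using AE_period_exists[of "\<lambda>u. a u = 0" "e / 2"] e by auto
    moreover from this have "cos e < cos \<bar>u\<bar>"
      using e by (intro cos_monotone_0_pi) auto
    ultimately show False by (simp add: a_def)
  qed
  moreover have "0 \<le> M" unfolding M_def by (rule integral_nonneg_AE) auto
  ultimately have M: "0 < M" by simp
  define \<phi> where "\<phi> u = a u / M" for u
  have [measurable]: "\<phi> \<in> borel_measurable borel"
    unfolding \<phi>_def by measurable
  have \<phi>_per: "\<phi> (t + 2 * pi) = \<phi> t" for t by (simp add: \<phi>_def a_per)
  have \<phi>_le: "\<bar>\<phi> t\<bar> \<le> 1 / M" for t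
    using a_le M by (simp add: \<phi>_def divide_right_mono)
  have \<phi>_int: "integrable period \<phi>"
    using a_int by (simp add: \<phi>_def[abs_def])
  have \<phi>0: "(LINT t|period. \<phi> t) = 0"
    using a0 by (simp add: \<phi>_def)
  have abs1: "(LINT t|period. \<bar>\<phi> t\<bar>) = 1"
    using M by (simp add: \<phi>_def M_def[symmetric])
  have norm1: "(\<integral>\<^sup>+t. ennreal \<bar>\<phi> t\<bar> \<partial>period) = 1"
    using \<phi>_int abs1 by (subst nn_integral_eq_integral) auto
  have conv_int: "integrable period (conv \<phi>)"
  proof (rule integrableI_bounded)
    show "conv \<phi> \<in> borel_measurable period"
      by (intro borel_measurable_periodI conv_measurable) measurable
    have "(\<integral>\<^sup>+x. ennreal \<bar>conv \<phi> x\<bar> \<partial>period) \<le> ennreal E"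
      using norm1 by (intro nn_integral_conv_le \<phi>_per \<phi>_int \<phi>0) auto
    then show "(\<integral>\<^sup>+x. ennreal (norm (conv \<phi> x)) \<partial>period) < \<infinity>"
      by (auto intro: order.strict_trans1)
  qed
  have "E - d = (LINT u|period. \<bar>\<phi> u\<bar> * (E - d))"
    using abs1 by simp
  also have "\<dots> \<le> (LINT u|period. \<phi> u * H u)"
  proof (rule integral_mono)
    show "integrable period (\<lambda>u. \<bar>\<phi> u\<bar> * (E - d))" using \<phi>_int by simp
    show "integrable period (\<lambda>u. \<phi> u * H u)"
      using \<phi>_int by (rule integrable_period_mult_bounded[OF _ _ H_bound]) measurable
    fix u
    have "\<bar>a u\<bar> * (E - d) \<le> a u * H u"
      using near[of u] near[of "u + pi"] cos_e by (auto simp: a_def H_shift)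
    then show "\<bar>\<phi> u\<bar> * (E - d) \<le> \<phi> u * H u"
      using M by (simp add: \<phi>_def divide_right_mono)
  qed
  also have "\<dots> = (LINT x|period. conv \<phi> x * s x)"
    by (rule integral_conv_s[symmetric, where C = "1 / M"]) (use \<phi>_per \<phi>_le in auto)
  also have "\<dots> \<le> (LINT x|period. \<bar>conv \<phi> x\<bar>)"
  proof (rule integral_mono)
    show "integrable period (\<lambda>x. conv \<phi> x * s x)"
      using conv_int by (rule integrable_period_mult_bounded[OF _ _ s_bound]) measurable
    show "conv \<phi> x * s x \<le> \<bar>conv \<phi> x\<bar>" for x
      using mult_left_mono[OF s_bound[of x] abs_ge_zero[of "conv \<phi> x"]] abs_ge_self[of "conv \<phi> x * s x"]
      by (simp add: abs_mult)
  qed (use conv_int in simp)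
  finally have "ennreal (E - d) \<le> ennreal (LINT x|period. \<bar>conv \<phi> x\<bar>)"
    by (rule ennreal_leI)
  also have "\<dots> = (\<integral>\<^sup>+x. ennreal \<bar>conv \<phi> x\<bar> \<partial>period)"
    using conv_int by (subst nn_integral_eq_integral) auto
  finally show ?thesis
    using that[of \<phi>] \<phi>_per \<phi>0 norm1 by simp
qed

text \<open>The convolution is \<open>H (- x)\<close>, which stays above \<open>E - d\<close> on an
  interval around 0. This interval has positive measure, hence contains a point outside the
  exceptional set of the essential supremum.\<close>

lemma extremal_sup:
  assumes "0 < d"
  shows "ennreal (E - d) \<le> esssup period (\<lambda>x. ennreal \<bar>conv (\<lambda>u. s (- u)) x\<bar>)"
proof -
  obtain e where e: "0 < e" "e \<le> pi / 2" and near: "\<And>u. cos e < cos u \<Longrightarrow> E - d \<le> H u"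
    using H_near_E[OF assms] by blast
  obtain x where x: "\<bar>x\<bar> \<le> e / 2"
    and le: "ennreal \<bar>conv (\<lambda>u. s (- u)) x\<bar> \<le> esssup period (\<lambda>x. ennreal \<bar>conv (\<lambda>u. s (- u)) x\<bar>)"
    using AE_period_exists[OF esssup_AE[of "\<lambda>x. ennreal \<bar>conv (\<lambda>u. s (- u)) x\<bar>" period], of "e / 2"] e by auto
  have "cos e < cos \<bar>x\<bar>"
    using x e by (intro cos_monotone_0_pi) auto
  then have "E - d \<le> H (- x)" by (intro near) simp
  also have "H (- x) = conv (\<lambda>u. s (- u)) x"
    by (simp add: H_def conv_def)
  finally have "ennreal (E - d) \<le> ennreal \<bar>conv (\<lambda>u. s (- u)) x\<bar>"
    by (intro ennreal_leI) linarith
  with le show ?thesis by (rule order_trans[rotated])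
qed

theorem SUP_conv:
  assumes p: "p = 1 \<or> p = \<infinity>"
  shows "(SUP \<phi>\<in>H1 p. enn2ereal (Lp_norm p (conv \<phi>))) = ereal E"
proof (rule antisym)
  show "(SUP \<phi>\<in>H1 p. enn2ereal (Lp_norm p (conv \<phi>))) \<le> ereal E"
  proof (rule SUP_least)
    fix \<phi> assume \<phi>: "\<phi> \<in> H1 p"
    obtain g where g: "g \<in> borel_measurable borel" "\<And>t. g (t + 2 * pi) = g t"
      "AE t in lborel. \<phi> t = g t" "integrable period g" "(LINT t|period. g t) = 0" "Lp_norm p g \<le> 1"
      using H1_borel_version[OF p \<phi>] by blast
    have "\<phi> \<in> borel_measurable lebesgue"
      using \<phi> by (simp add: H1_def Lp_space_def)
    then have "conv \<phi> = conv g"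
      unfolding conv_def using g by (intro ext arg_cong2[where f = "(*)"] refl integral_period_conv_cong) auto
    moreover have "Lp_norm p (conv g) \<le> ennreal E"
    proof (cases "p = 1")
      case True
      then show ?thesis
        using nn_integral_conv_le[OF g(1,2,4,5)] Lp_norm_le_1_imp(2)[OF p g(6,1)] by (simp add: Lp_norm_1)
    next
      case False
      then have inf: "p = \<infinity>" using p by simp
      have "AE x in period. ennreal \<bar>conv g x\<bar> \<le> ennreal E"
        using conv_le_sup[OF g(1,2,4,5)] Lp_norm_le_1_imp(3)[OF p g(6,1) inf] by (intro AE_I2 ennreal_leI) auto
      moreover have "(\<lambda>x. ennreal \<bar>conv g x\<bar>) \<in> borel_measurable period"
        using conv_measurable[OF g(1)] by (intro borel_measurable_periodI) measurable
      ultimately show ?thesis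
        unfolding inf Lp_norm_infinity by (intro esssup_I)
    qed
    ultimately have "enn2ereal (Lp_norm p (conv \<phi>)) \<le> enn2ereal (ennreal E)"
      by (simp add: less_eq_ennreal.rep_eq)
    then show "enn2ereal (Lp_norm p (conv \<phi>)) \<le> ereal E"
      using E_nonneg by (simp add: enn2ereal_ennreal)
  qed
next
  show "ereal E \<le> (SUP \<phi>\<in>H1 p. enn2ereal (Lp_norm p (conv \<phi>)))"
  proof (rule ereal_le_epsilon2)
    fix d :: real assume "0 < d"
    obtain \<phi> where \<phi>: "\<phi> \<in> H1 p" "ennreal (E - d) \<le> Lp_norm p (conv \<phi>)"
    proof (cases "p = 1")
      case True
      then show ?thesis
        using exists_near_extremal_L1[OF \<open>0 < d\<close>] that by (metis H1_I Lp_norm_1)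
    next
      case False
      then have inf: "p = \<infinity>" using p by simp
      have "(LINT t|period. s (- t)) = (LINT t|period. s (0 - t))" by simp
      also have "\<dots> = (LINT t|period. s t)"
        by (rule integral_period_reflect) (auto simp: s_period)
      also have "\<dots> = (LINT t|period. s (t + pi))"
        by (rule integral_period_shift[symmetric]) (auto simp: s_period)
      also have "\<dots> = - (LINT t|period. s t)" by (simp add: s_shift)
      finally have "(LINT t|period. s (- t)) = 0"
        using integral_period_reflect[of s 0] s_period by simp
      moreover have "s (- (t + 2 * pi)) = s (- t)" for t
        using s_period[of "- (t + 2 * pi)"] by simp
      moreover have "Lp_norm p (\<lambda>u. s (- u)) \<le> 1"
        unfolding inf Lp_norm_infinity using s_bound
        by (intro esssup_I borel_measurable_periodI) auto
      ultimately have "(\<lambda>u. s (- u)) \<in> H1 p"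
        by (intro H1_I) auto
      then show ?thesis
        using that[of "\<lambda>u. s (- u)"] extremal_sup[OF \<open>0 < d\<close>] by (simp only: inf Lp_norm_infinity)
    qed
    \<comment> \<open>\<open>ennreal\<close> truncates negative numbers to 0, which is harmless: for
      \<open>E < d\<close> the claim is \<open>E \<le> 0 + d\<close>.\<close>
    have "ereal E \<le> enn2ereal (ennreal (E - d)) + ereal d"
      by (cases "0 \<le> E - d") (auto simp: enn2ereal_ennreal ennreal_neg zero_ennreal.rep_eq)
    also have "\<dots> \<le> (SUP \<phi>\<in>H1 p. enn2ereal (Lp_norm p (conv \<phi>))) + ereal d"
      using \<phi> by (intro add_right_mono SUP_upper2[of \<phi>]) (auto simp: less_eq_ennreal.rep_eq)
    finally show "ereal E \<le> (SUP \<phi>\<in>H1 p. enn2ereal (Lp_norm p (conv \<phi>))) + ereal d" .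
  qed
qed

end

subsection \<open>Fourier series of the convolution\<close>

text \<open>Convergence at every point with uniformly bounded partial sums: weak enough for the
  conditionally convergent sawtooth series, strong enough to integrate termwise against any
  integrable function.\<close>

definition bounded_sums :: "(nat \<Rightarrow> real \<Rightarrow> real) \<Rightarrow> (real \<Rightarrow> real) \<Rightarrow> real \<Rightarrow> bool"
  where "bounded_sums u U B \<longleftrightarrow>
    (\<forall>j. u j \<in> borel_measurable borel) \<and> (\<forall>t. (\<lambda>j. u j t) sums U t) \<and> (\<forall>n t. \<bar>\<Sum>j<n. u j t\<bar> \<le> B)"

lemma bounded_sums_measurable:
  assumes "bounded_sums u U B"
  shows "U \<in> borel_measurable borel"
proof -
  have "U = (\<lambda>t. \<Sum>j. u j t)"
    using assms by (auto simp: bounded_sums_def sums_iff)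
  moreover have "(\<lambda>t. \<Sum>j. u j t) \<in> borel_measurable borel"
    using assms by (intro borel_measurable_suminf) (auto simp: bounded_sums_def)
  ultimately show ?thesis by simp
qed

lemma bounded_sums_le:
  assumes "bounded_sums u U B"
  shows "\<bar>U t\<bar> \<le> B"
proof (rule LIMSEQ_le_const2[of "\<lambda>n. \<bar>\<Sum>j<n. u j t\<bar>"])
  show "(\<lambda>n. \<bar>\<Sum>j<n. u j t\<bar>) \<longlonglongrightarrow> \<bar>U t\<bar>"
    using assms by (intro tendsto_rabs) (auto simp: bounded_sums_def sums_def)
qed (use assms in \<open>auto simp: bounded_sums_def\<close>)

lemma bounded_sums_term_le:
  assumes "bounded_sums u U B"
  shows "\<bar>u j t\<bar> \<le> B + B"
proof -
  have "u j t = (\<Sum>i<Suc j. u i t) - (\<Sum>i<j. u i t)" by simp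
  moreover have "\<bar>\<Sum>i<n. u i t\<bar> \<le> B" for n
    using assms by (simp add: bounded_sums_def)
  ultimately show ?thesis by (metis abs_triangle_ineq4 add_mono order_trans)
qed

lemma bounded_sums_cmult:
  assumes "bounded_sums u U B"
  shows "bounded_sums (\<lambda>j t. a * u j t) (\<lambda>t. a * U t) (\<bar>a\<bar> * B)"
  using assms unfolding bounded_sums_def
  by (auto simp: abs_mult intro!: sums_mult mult_left_mono borel_measurable_times simp flip: sum_distrib_left)

lemma bounded_sums_comparison:
  assumes "\<And>j. u j \<in> borel_measurable borel" "\<And>j t. \<bar>u j t\<bar> \<le> a j" "summable a"
  shows "bounded_sums u (\<lambda>t. \<Sum>j. u j t) (\<Sum>j. a j)"
  unfolding bounded_sums_def
proof (intro conjI allI)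
  show "u j \<in> borel_measurable borel" for j by fact
  show "(\<lambda>j. u j t) sums (\<Sum>j. u j t)" for t
    by (rule summable_sums, rule summable_comparison_test'[OF assms(3), of 0]) (simp add: assms(2))
  show "\<bar>\<Sum>j<n. u j t\<bar> \<le> (\<Sum>j. a j)" for n t
  proof -
    have "\<bar>\<Sum>j<n. u j t\<bar> \<le> (\<Sum>j<n. a j)"
      by (rule order_trans[OF sum_abs]) (intro sum_mono assms)
    also have "\<dots> \<le> (\<Sum>j. a j)"
      using assms(2) by (intro sum_le_suminf assms(3)) (auto intro: order_trans[OF abs_ge_zero])
    finally show ?thesis .
  qed
qed

lemma bounded_sums_integral:
  assumes u: "bounded_sums u U B" and h: "integrable period h"
  shows "(\<lambda>j. LINT t|period. h t * u j t) sums (LINT t|period. h t * U t)"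
proof -
  have u_meas: "u j \<in> borel_measurable borel" for j
    using u by (simp add: bounded_sums_def)
  have [measurable]: "u j \<in> borel_measurable period" "U \<in> borel_measurable period" "h \<in> borel_measurable period" for j
    using borel_measurable_periodI[OF u_meas] borel_measurable_periodI[OF bounded_sums_measurable[OF u]] h by auto
  have "(\<lambda>n. LINT t|period. h t * (\<Sum>j<n. u j t)) \<longlonglongrightarrow> (LINT t|period. h t * U t)"
  proof (rule integral_dominated_convergence)
    show "integrable period (\<lambda>t. B * \<bar>h t\<bar>)" using h by simp
    show "AE t in period. (\<lambda>n. h t * (\<Sum>j<n. u j t)) \<longlonglongrightarrow> h t * U t"
      using u by (intro AE_I2 tendsto_intros) (auto simp: bounded_sums_def sums_def)
    show "AE t in period. norm (h t * (\<Sum>j<n. u j t)) \<le> B * \<bar>h t\<bar>" for n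
    proof (intro AE_I2)
      fix t
      have "\<bar>h t\<bar> * \<bar>\<Sum>j<n. u j t\<bar> \<le> \<bar>h t\<bar> * B"
        using u by (intro mult_left_mono) (auto simp: bounded_sums_def)
      then show "norm (h t * (\<Sum>j<n. u j t)) \<le> B * \<bar>h t\<bar>"
        by (simp add: abs_mult mult.commute)
    qed
  qed measurable
  moreover have "integrable period (\<lambda>t. h t * u j t)" for j
    by (rule integrable_period_mult_bounded[OF h u_meas bounded_sums_term_le[OF u]])
  ultimately show ?thesis
    unfolding sums_def by (simp add: sum_distrib_left)
qed

text \<open>The weights \<open>1 - w j\<close> equal 1 from \<open>m\<close> on, so the series
  changes in finitely many terms only, and \<open>V\<close> inherits everything from
  \<open>U\<close> after subtraction of a finite sum.\<close>

lemma bounded_sums_weighted: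
  assumes u: "bounded_sums u U B" and w: "\<And>j. m \<le> j \<Longrightarrow> w j = 0"
  defines "V \<equiv> \<lambda>t. U t - (\<Sum>j<m. w j * u j t)"
  shows "(\<lambda>j. (1 - w j) * u j t) sums V t"
    and "integrable period h \<Longrightarrow>
      (\<lambda>j. (1 - w j) * (LINT t|period. h t * u j t)) sums (LINT t|period. h t * V t)"
    and "V \<in> borel_measurable borel" and "\<exists>C. \<forall>t. \<bar>V t\<bar> \<le> C"
proof -
  have u_meas [measurable]: "u j \<in> borel_measurable borel" for j
    using u by (simp add: bounded_sums_def)
  have [measurable]: "U \<in> borel_measurable borel"
    by (rule bounded_sums_measurable[OF u])
  have fin: "(\<lambda>j. w j * x j) sums (\<Sum>j<m. w j * x j)" for x :: "nat \<Rightarrow> real"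
    using w by (intro sums_finite) auto
  have eq: "(\<lambda>j. x j - w j * x j) = (\<lambda>j. (1 - w j) * x j)" for x :: "nat \<Rightarrow> real"
    by (simp add: algebra_simps)
  show "(\<lambda>j. (1 - w j) * u j t) sums V t"
    unfolding V_def eq[symmetric] using u by (intro sums_diff fin) (auto simp: bounded_sums_def)
  note u_le = bounded_sums_term_le[OF u]
  show "V \<in> borel_measurable borel"
    unfolding V_def by measurable
  show "\<exists>C. \<forall>t. \<bar>V t\<bar> \<le> C"
  proof (intro exI allI)
    fix t
    have "\<bar>\<Sum>j<m. w j * u j t\<bar> \<le> (\<Sum>j<m. \<bar>w j\<bar> * (B + B))"
      by (rule order_trans[OF sum_abs]) (intro sum_mono, simp add: abs_mult mult_left_mono u_le[simplified])
    then show "\<bar>V t\<bar> \<le> B + (\<Sum>j<m. \<bar>w j\<bar> * (B + B))"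
      unfolding V_def using bounded_sums_le[OF u, of t] by linarith
  qed
  assume h: "integrable period h"
  have hu: "integrable period (\<lambda>t. h t * u j t)" for j
    by (rule integrable_period_mult_bounded[OF h u_meas u_le])
  have hU: "integrable period (\<lambda>t. h t * U t)"
    by (rule integrable_period_mult_bounded[OF h _ bounded_sums_le[OF u]]) measurable
  have "(LINT t|period. h t * V t) = (LINT t|period. h t * U t - (\<Sum>j<m. w j * (h t * u j t)))"
    by (simp add: V_def right_diff_distrib sum_distrib_left mult.left_commute)
  also have "\<dots> = (LINT t|period. h t * U t) - (\<Sum>j<m. w j * (LINT t|period. h t * u j t))"
    using hu hU by simp
  finally show "(\<lambda>j. (1 - w j) * (LINT t|period. h t * u j t)) sums (LINT t|period. h t * V t)"
    unfolding eq[symmetric] by (simp only:) (intro sums_diff fin bounded_sums_integral[OF u h])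
qed

lemma divide_powr_le_inverse_square:
  assumes "2 \<le> q" "\<bar>x\<bar> \<le> 1"
  shows "\<bar>x / real (Suc j) powr q\<bar> \<le> 1 / real (Suc j) ^ 2"
proof -
  have "\<bar>x\<bar> / real (Suc j) powr q \<le> 1 / real (Suc j) powr 2"
    using assms by (intro frac_le powr_mono) auto
  then show ?thesis by (simp add: powr_numeral del: of_nat_Suc)
qed

lemma bounded_sums_cos:
  assumes "2 \<le> q"
  shows "bounded_sums (\<lambda>j t. cos (real (Suc j) * t) / real (Suc j) powr q)
    (\<lambda>t. \<Sum>j. cos (real (Suc j) * t) / real (Suc j) powr q) (\<Sum>j. 1 / real (Suc j) ^ 2)"
  by (intro bounded_sums_comparison summable_inverse_squares_Suc divide_powr_le_inverse_square assms abs_cos_le_one)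
    measurable

text \<open>For \<open>q = 1\<close> the bound and the limit are available on one period and on its
  positive half respectively; oddness and \<open>wrap\<close> extend them to the whole line.\<close>

lemma bounded_sums_sin:
  assumes "q = 1 \<or> 2 \<le> q"
  shows "\<exists>B. bounded_sums (\<lambda>j t. sin (real (Suc j) * t) / real (Suc j) powr q)
    (\<lambda>t. \<Sum>j. sin (real (Suc j) * t) / real (Suc j) powr q) B"
proof (cases "2 \<le> q")
  case True
  have "bounded_sums (\<lambda>j t. sin (real (Suc j) * t) / real (Suc j) powr q)
    (\<lambda>t. \<Sum>j. sin (real (Suc j) * t) / real (Suc j) powr q) (\<Sum>j. 1 / real (Suc j) ^ 2)"
    by (intro bounded_sums_comparison summable_inverse_squares_Suc divide_powr_le_inverse_square True abs_sin_le_one)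
      measurable
  then show ?thesis ..
next
  case False
  then have q: "q = 1" using assms by simp
  have wrap: "sin (real (Suc j) * wrap t) = sin (real (Suc j) * t)" for j t
  proof (rule periodic_wrap[of "\<lambda>t. sin (real (Suc j) * t)"])
    fix t
    have "sin (real (Suc j) * t + of_int (int (Suc j)) * (2 * pi)) = sin (real (Suc j) * t)"
      using sin.plus_of_int[of "real (Suc j) * t" "int (Suc j)"] by (simp only: of_real_eq_id id_apply)
    then show "sin (real (Suc j) * (t + 2 * pi)) = sin (real (Suc j) * t)"
      by (simp add: algebra_simps)
  qed
  have pos: "summable (\<lambda>j. sin (real (Suc j) * t) / real (Suc j))" if "0 \<le> t" "t \<le> pi" for t
    using sums_summable[OF sawtooth_sums[of t]] that by (cases "t = 0") auto
  have summable: "summable (\<lambda>j. sin (real (Suc j) * t) / real (Suc j))" for t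
  proof (cases "0 \<le> wrap t")
    case True
    then show ?thesis
      using pos[of "wrap t"] wrap_bounds[of t] unfolding wrap by simp
  next
    case False
    then have "summable (\<lambda>j. - (sin (real (Suc j) * (- wrap t)) / real (Suc j)))"
      using pos[of "- wrap t"] wrap_bounds[of t] by (intro summable_minus) auto
    then show ?thesis
      by (simp add: wrap del: of_nat_Suc)
  qed
  have "\<bar>\<Sum>j<n. sin (real (Suc j) * t) / real (Suc j)\<bar> \<le> pi / 2 + 1" for n t
    using abs_sine_sum_le[of "wrap t" n] wrap_bounds[of t] unfolding wrap by (simp add: abs_le_iff)
  then show ?thesis
    unfolding q bounded_sums_def using summable
    by (intro exI[of _ "pi / 2 + 1"] conjI allI) (auto intro: summable_sums simp del: of_nat_Suc)
qed

section \<open>Trigonometric integrals over a period\<close>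

lemma integral_period_FTC:
  assumes "\<And>x. (F has_field_derivative f x) (at x)" "continuous_on UNIV f"
  shows "(LINT t|period. f t) = F pi - F (- pi)"
proof -
  have "integrable period f"
    by (rule continuous_imp_integrable_real[OF continuous_on_subset[OF assms(2)]]) simp
  then have "(LINT t|period. f t) = integral {-pi..pi} f"
    by (rule lebesgue_integral_eq_integral) simp
  moreover have "(f has_integral (F pi - F (- pi))) {-pi..pi}"
    by (rule fundamental_theorem_of_calculus)
      (auto intro!: DERIV_subset[OF assms(1)] simp flip: has_real_derivative_iff_has_vector_derivative)
  ultimately show ?thesis by (simp add: integral_unique)
qed

lemma integral_period_cos:
  "(LINT t|period. cos (of_int n * t + b)) = (if n = 0 then 2 * pi * cos b else 0)"
proof (cases "n = 0")
  case False
  have "(LINT t|period. cos (of_int n * t + b)) = sin (of_int n * pi + b) / of_int n - sin (of_int n * (- pi) + b) / of_int n"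
    by (rule integral_period_FTC[where F = "\<lambda>t. sin (of_int n * t + b) / of_int n"])
      (use False in \<open>auto intro!: derivative_eq_intros continuous_intros\<close>)
  also have "sin (of_int n * pi + b) = sin (of_int n * (- pi) + b)"
  proof -
    have "sin (of_int n * pi) = 0" using sin_zero_iff_int2 by blast
    then show ?thesis by (simp add: sin_add sin_diff)
  qed
  finally show ?thesis using False by simp
qed (simp add: measure_restrict_space)

text \<open>Translation by \<open>\<theta>\<close> moves the sign changes to \<open>- pi / 2\<close>
  and \<open>pi / 2\<close> at the price of the phase \<open>(k - 1) * \<theta>\<close>. The
  integral is then elementary on three intervals of constant sign.\<close>

lemma integral_period_sgn_cos:
  assumes "0 < k"
  shows "(LINT t|period. sgn (cos (t - \<theta>)) * cos (real k * t - \<theta>)) =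
    4 * cos ((real k - 1) * \<theta>) * sin (real k * pi / 2) / real k"
proof -
  define b where "b = (real k - 1) * \<theta>"
  define f where "f t = sgn (cos t) * cos (real k * t + b)" for t
  have [measurable]: "f \<in> borel_measurable borel"
    unfolding f_def by measurable
  have per: "f (t + 2 * pi) = f t" for t
  proof -
    have "cos (real k * t + b + of_int (int k) * (2 * pi)) = cos (real k * t + b)"
      using cos.plus_of_int[of "real k * t + b" "int k"] by (simp only: of_real_eq_id id_apply)
    then have "cos (real k * (t + 2 * pi) + b) = cos (real k * t + b)"
      by (simp add: algebra_simps)
    then show ?thesis by (simp add: f_def)
  qed
  have "(LINT t|period. sgn (cos (t - \<theta>)) * cos (real k * t - \<theta>)) = (LINT t|period. f (t + - \<theta>))"
    by (simp add: f_def b_def algebra_simps)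
  also have "\<dots> = (LINT t|period. f t)"
    by (rule integral_period_shift) (auto simp: per)
  also have "\<dots> = integral {-pi..pi} f"
  proof (rule lebesgue_integral_eq_integral)
    have "\<bar>f t\<bar> \<le> 1" for t
      by (simp add: f_def abs_mult abs_sgn_eq)
    then show "integrable period f"
      by (intro integrable_period_bounded) auto
  qed simp
  also have "(f has_integral 4 * cos b * sin (real k * pi / 2) / real k) {-pi..pi}"
  proof -
    define F where "F t = sin (real k * t + b) / real k" for t
    have F: "((\<lambda>t. a * F t) has_field_derivative a * cos (real k * t + b)) (at t)" for a t
      unfolding F_def using assms by (auto intro!: derivative_eq_intros)
    have piece: "(f has_integral a * F y - a * F x) {x..y}"
      if "x \<le> y" and "\<And>t. x < t \<Longrightarrow> t < y \<Longrightarrow> sgn (cos t) = a" for a x y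
    proof (rule fundamental_theorem_of_calculus_interior[OF that(1)])
      show "continuous_on {x..y} (\<lambda>t. a * F t)"
        unfolding F_def by (intro continuous_intros) (use assms in auto)
      show "((\<lambda>t. a * F t) has_vector_derivative f t) (at t)" if "t \<in> {x<..<y}" for t
        using F[of a t] that \<open>\<And>t. x < t \<Longrightarrow> t < y \<Longrightarrow> sgn (cos t) = a\<close>[of t]
        by (simp add: f_def flip: has_real_derivative_iff_has_vector_derivative)
    qed
    have "(f has_integral (- 1) * F (- pi / 2) - (- 1) * F (- pi)) {-pi..-pi / 2}"
    proof (rule piece)
      fix t :: real assume "- pi < t" "t < - pi / 2"
      then have "0 < cos (t + pi)" by (intro cos_gt_zero_pi) auto
      then show "sgn (cos t) = - 1" by simp
    qed simp
    moreover have "(f has_integral 1 * F (pi / 2) - 1 * F (- pi / 2)) {-pi / 2..pi / 2}"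
      by (rule piece) (auto intro!: sgn_pos cos_gt_zero_pi)
    ultimately have "(f has_integral ((- 1) * F (- pi / 2) - (- 1) * F (- pi)) + (1 * F (pi / 2) - 1 * F (- pi / 2))) {-pi..pi / 2}"
      by (rule has_integral_combine[rotated 2]) auto
    moreover have "(f has_integral (- 1) * F pi - (- 1) * F (pi / 2)) {pi / 2..pi}"
    proof (rule piece)
      fix t :: real assume "pi / 2 < t" "t < pi"
      then have "0 < cos (t - pi)" by (intro cos_gt_zero_pi) auto
      then show "sgn (cos t) = - 1" by simp
    qed simp
    ultimately have "(f has_integral ((- 1) * F (- pi / 2) - (- 1) * F (- pi)) + (1 * F (pi / 2) - 1 * F (- pi / 2)) +
        ((- 1) * F pi - (- 1) * F (pi / 2))) {-pi..pi}"
      by (rule has_integral_combine[rotated 2]) auto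
    also have "((- 1) * F (- pi / 2) - (- 1) * F (- pi)) + (1 * F (pi / 2) - 1 * F (- pi / 2)) +
        ((- 1) * F pi - (- 1) * F (pi / 2)) = 4 * cos b * sin (real k * pi / 2) / real k"
    proof -
      have "sin (real k * pi) = 0" by simp
      then have 1: "sin (real k * (- pi) + b) = sin (real k * pi + b)"
        by (simp add: sin_add sin_diff)
      have "sin (real k * (pi / 2) + b) - sin (real k * (- pi / 2) + b) = 2 * cos b * sin (real k * pi / 2)"
        by (simp add: sin_add sin_diff)
      then show ?thesis
        unfolding F_def 1 using assms by (simp add: divide_simps)
    qed
    finally show ?thesis .
  qed
  then have "integral {-pi..pi} f = 4 * cos b * sin (real k * pi / 2) / real k"
    by (rule integral_unique)
  finally show ?thesis by (simp add: b_def)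
qed

section \<open>Cesaro means of a convolution\<close>

lemma Re_fourier_term:
  assumes f: "integrable period f"
  shows "Re (complex_of_real a * fourier_coeff f k * exp (\<i> * of_int k * complex_of_real x)) =
    a * (1 / (2 * pi) * (LINT t|period. f t * cos (of_int k * (x - t))))"
proof -
  have int: "integrable period (\<lambda>t. complex_of_real (f t) * exp (- (\<i> * of_int k * complex_of_real t)) *
      exp (\<i> * of_int k * complex_of_real x))"
  proof (rule Bochner_Integration.integrable_bound[OF f])
    have [measurable]: "f \<in> borel_measurable period" using f by simp
    note [measurable] = measurable_ident_period
    show "(\<lambda>t. complex_of_real (f t) * exp (- (\<i> * of_int k * complex_of_real t)) *
      exp (\<i> * of_int k * complex_of_real x)) \<in> borel_measurable period"
      by measurable
  qed (simp add: norm_mult)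
  have "Re (complex_of_real (f t) * exp (- (\<i> * of_int k * complex_of_real t)) *
      exp (\<i> * of_int k * complex_of_real x)) = f t * cos (of_int k * (x - t))" for t
  proof -
    have "exp (- (\<i> * of_int k * complex_of_real t)) * exp (\<i> * of_int k * complex_of_real x)
        = exp (\<i> * complex_of_real (of_int k * (x - t)))"
      unfolding exp_add[symmetric] by (simp add: algebra_simps)
    then show ?thesis by (simp add: mult.assoc Re_exp)
  qed
  then have "Re (LINT t|period. complex_of_real (f t) * exp (- (\<i> * of_int k * complex_of_real t)) *
      exp (\<i> * of_int k * complex_of_real x)) = (LINT t|period. f t * cos (of_int k * (x - t)))"
    using integral_Re[OF int] by simp
  then have "Re ((LINT t|period. complex_of_real (f t) * exp (- (\<i> * of_int k * complex_of_real t))) *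
      exp (\<i> * of_int k * complex_of_real x)) = (LINT t|period. f t * cos (of_int k * (x - t)))"
    by simp
  moreover have "complex_of_real a * fourier_coeff f k * exp (\<i> * of_int k * complex_of_real x)
      = complex_of_real (a * (1 / (2 * pi))) *
        ((LINT t|period. complex_of_real (f t) * exp (- (\<i> * of_int k * complex_of_real t))) *
          exp (\<i> * of_int k * complex_of_real x))"
    by (simp add: fourier_coeff_def)
  ultimately show ?thesis
    unfolding scaleR_conv_of_real[symmetric] by simp
qed

lemma sum_symmetric_int:
  fixes F :: "nat \<Rightarrow> real"
  shows "(\<Sum>k\<in>{- int m..int m}. F (nat \<bar>k\<bar>)) = F 0 + 2 * (\<Sum>j<m. F (Suc j))"
proof (induction m)
  case (Suc m)
  have "{- int (Suc m)..int (Suc m)} = insert (int (Suc m)) (insert (- int (Suc m)) {- int m..int m})"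
    by auto
  then show ?case using Suc.IH by (simp add: nat_add_distrib)
qed simp

text \<open>Pairing the frequencies \<open>k\<close> and \<open>- k\<close> turns
  \<open>1 / (2 * pi)\<close> into \<open>1 / pi\<close>; the assumption on \<open>F 0 x\<close>
  says that \<open>f\<close> has mean zero and removes the unpaired term.\<close>

lemma cesaro_mean_eq:
  assumes f: "integrable period f"
  defines "F \<equiv> \<lambda>n x. LINT t|period. f t * cos (real n * (x - t))"
  assumes "F 0 x = 0"
  shows "cesaro_mean \<alpha> m f x =
    1 / pi * (\<Sum>j<m. cesaro_number \<alpha> (int m - int (Suc j)) / cesaro_number \<alpha> (int m) * F (Suc j) x)"
proof -
  define G where "G n = cesaro_number \<alpha> (int m - int n) / cesaro_number \<alpha> (int m) * (1 / (2 * pi) * F n x)" for n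
  have cos_abs: "cos (of_int k * y) = cos (real (nat \<bar>k\<bar>) * y)" for k :: int and y
    by (cases "0 \<le> k") simp_all
  have "cesaro_mean \<alpha> m f x = (\<Sum>k\<in>{- int m..int m}.
      cesaro_number \<alpha> (int m - \<bar>k\<bar>) / cesaro_number \<alpha> (int m) *
        (1 / (2 * pi) * (LINT t|period. f t * cos (of_int k * (x - t)))))"
    unfolding cesaro_mean_def Re_sum Re_fourier_term[OF f] ..
  also have "\<dots> = (\<Sum>k\<in>{- int m..int m}. G (nat \<bar>k\<bar>))"
    by (simp add: G_def F_def cos_abs)
  also have "\<dots> = 2 * (\<Sum>j<m. G (Suc j))"
    unfolding sum_symmetric_int using assms(3) by (simp add: G_def)
  also have "\<dots> = 1 / pi * (\<Sum>j<m. cesaro_number \<alpha> (int m - int (Suc j)) / cesaro_number \<alpha> (int m) * F (Suc j) x)"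
    by (simp add: G_def sum_distrib_left mult_ac)
  finally show ?thesis .
qed

text \<open>For \<open>p = 1\<close> the function \<open>g\<close> may be unbounded; integrability
  on the square follows since the integral of \<open>\<bar>g (x - t)\<bar>\<close> over
  \<open>t\<close> does not depend on \<open>x\<close>.\<close>

lemma integrable_period_pair_shift:
  fixes g :: "real \<Rightarrow> real"
  assumes g [measurable]: "g \<in> borel_measurable borel" and per: "\<And>t. g (t + 2 * pi) = g t"
    and int: "integrable period g"
    and b: "b \<in> borel_measurable (period \<Otimes>\<^sub>M period)" "\<And>q. \<bar>b q\<bar> \<le> B"
  shows "integrable (period \<Otimes>\<^sub>M period) (\<lambda>(x, t). g (x - t) * b (x, t))"
proof (rule Bochner_Integration.integrable_bound)
  note [measurable] = measurable_fst_period measurable_snd_period b(1)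
  have int_abs: "integrable period (\<lambda>t. \<bar>g t\<bar>)" using int by simp
  have "integrable (period \<Otimes>\<^sub>M period) (\<lambda>(x, t). g (x - t))"
  proof (rule period_pair.Fubini_integrable)
    have "(LINT t|period. \<bar>g (x - t)\<bar>) = (LINT t|period. \<bar>g t\<bar>)" for x
      by (rule integral_period_reflect[where f = "\<lambda>t. \<bar>g t\<bar>"]) (auto simp: per)
    then show "integrable period (\<lambda>x. LINT t|period. norm (case (x, t) of (x, t) \<Rightarrow> g (x - t)))"
      by simp
    show "AE x in period. integrable period (\<lambda>t. case (x, t) of (x, t) \<Rightarrow> g (x - t))"
      using int by (simp add: integrable_period_reflect_iff per)
  qed measurable
  then show "integrable (period \<Otimes>\<^sub>M period) (\<lambda>q. B * (case q of (x, t) \<Rightarrow> g (x - t)))"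
    by simp
  show "(\<lambda>(x, t). g (x - t) * b (x, t)) \<in> borel_measurable (period \<Otimes>\<^sub>M period)"
    by measurable
  have "\<bar>g (x - t)\<bar> * \<bar>b (x, t)\<bar> \<le> \<bar>g (x - t)\<bar> * \<bar>B\<bar>" for x t
    using b(2)[of "(x, t)"] by (intro mult_left_mono) auto
  then show "AE q in period \<Otimes>\<^sub>M period.
      norm (case q of (x, t) \<Rightarrow> g (x - t) * b (x, t)) \<le> norm (B * (case q of (x, t) \<Rightarrow> g (x - t)))"
    by (auto simp: abs_mult mult.commute)
qed

lemma integral_convolution_cos:
  fixes g P :: "real \<Rightarrow> real"
  assumes g [measurable]: "g \<in> borel_measurable borel" and per: "\<And>t. g (t + 2 * pi) = g t"
    and int: "integrable period g"
    and P [measurable]: "P \<in> borel_measurable borel" and P_le: "\<And>t. \<bar>P t\<bar> \<le> B"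
  shows "(LINT y|period. (LINT t|period. g (y - t) * P t) * cos (real n * (x - y))) =
    (LINT v|period. g (x - v) * (LINT t|period. cos (real n * (v - t)) * P t))"
proof -
  note [measurable] = measurable_fst_period measurable_snd_period
  have le: "\<bar>P t * cos y\<bar> \<le> B" for t y
    using mult_mono[OF P_le[of t] abs_cos_le_one[of y] order_trans[OF abs_ge_zero P_le[of t]]]
    by (simp add: abs_mult)
  have cos_per: "cos (real n * (y - (t + 2 * pi))) = cos (real n * (y - t))" for y t
    using cos.minus_of_int[of "real n * (y - t)" "int n"] by (simp add: algebra_simps)
  have "(LINT y|period. (LINT t|period. g (y - t) * P t) * cos (real n * (x - y)))
      = (LINT y|period. LINT t|period. g (y - t) * (P t * cos (real n * (x - y))))"
    by (simp add: mult.assoc flip: Bochner_Integration.integral_mult_left_zero)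
  also have "\<dots> = (LINT t|period. LINT y|period. g (y - t) * (P t * cos (real n * (x - y))))"
    using integrable_period_pair_shift[OF g per int, of "\<lambda>(y, t). P t * cos (real n * (x - y))" B] le
    by (intro period_pair.Fubini_integral[symmetric]) (auto simp: split_beta)
  also have "\<dots> = (LINT t|period. LINT v|period. g (x - v) * (cos (real n * (v - t)) * P t))"
  proof (rule Bochner_Integration.integral_cong[OF refl])
    fix t
    have g_per: "g (y + 2 * pi - t) = g (y - t)" for y
      using per[of "y - t"] by (simp add: algebra_simps)
    \<comment> \<open>Substituting \<open>y = x + t - v\<close> gives \<open>y - t = x - v\<close>
      and \<open>x - y = v - t\<close>.\<close>
    have "(LINT y|period. g (y - t) * (P t * cos (real n * (x - y))))
        = (LINT v|period. g ((x + t - v) - t) * (P t * cos (real n * (x - (x + t - v)))))"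
      by (rule integral_period_reflect[symmetric]) (measurable, simp only: cos_per g_per)
    then show "(LINT y|period. g (y - t) * (P t * cos (real n * (x - y))))
        = (LINT v|period. g (x - v) * (cos (real n * (v - t)) * P t))"
      by (simp add: mult.commute)
  qed
  also have "\<dots> = (LINT v|period. LINT t|period. g (x - v) * (cos (real n * (v - t)) * P t))"
  proof (rule period_pair.Fubini_integral)
    have gx: "integrable period (\<lambda>v. g (x - v))"
      using int by (simp add: integrable_period_reflect_iff per)
    have "integrable (period \<Otimes>\<^sub>M period) (\<lambda>(v, t). g (x - v))"
      by (rule period_pair.Fubini_integrable) (use gx in \<open>auto simp: split_beta\<close>)
    then have int_B: "integrable (period \<Otimes>\<^sub>M period) (\<lambda>q. B * (case q of (v, t) \<Rightarrow> g (x - v)))"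
      by simp
    show "integrable (period \<Otimes>\<^sub>M period) (\<lambda>(v, t). g (x - v) * (cos (real n * (v - t)) * P t))"
    proof (rule Bochner_Integration.integrable_bound[OF int_B])
      have "\<bar>g (x - v)\<bar> * \<bar>cos (real n * (v - t)) * P t\<bar> \<le> \<bar>g (x - v)\<bar> * \<bar>B\<bar>" for v t
        using le[of t "real n * (v - t)"] by (intro mult_left_mono) (auto simp: mult.commute)
      then show "AE q in period \<Otimes>\<^sub>M period. norm (case q of (v, t) \<Rightarrow> g (x - v) * (cos (real n * (v - t)) * P t))
          \<le> norm (B * (case q of (v, t) \<Rightarrow> g (x - v)))"
        by (auto simp: abs_mult mult.commute)
    qed measurable
  qed
  finally show ?thesis by simp
qed

definition psi_term :: "real \<Rightarrow> real \<Rightarrow> nat \<Rightarrow> real \<Rightarrow> real"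
  where "psi_term r \<theta> j t = 2 * cos (real (Suc j) * t - \<theta>) / real (Suc j) powr r"

text \<open>The product formula leaves the frequencies \<open>Suc j - n\<close> and
  \<open>Suc j + n\<close>; only the first can be 0, namely for \<open>j = n - 1\<close>. The case
  \<open>n = 0\<close> is separate because the series has no constant term.\<close>

lemma integral_psi_cos:
  assumes "bounded_sums (psi_term r \<theta>) P B"
  shows "(LINT t|period. cos (real n * (v - t)) * P t) =
    (if n = 0 then 0 else pi * psi_term r \<theta> (n - 1) v)"
proof -
  have single: "(LINT t|period. cos (real n * (v - t)) * psi_term r \<theta> j t) =
      (if Suc j = n then pi * psi_term r \<theta> j v else 0)" for j
  proof -
    have "(LINT t|period. cos (real n * (v - t)) * psi_term r \<theta> j t)
        = (LINT t|period. (cos (of_int (int (Suc j) - int n) * t + (real n * v - \<theta>)) +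
            cos (of_int (int (Suc j) + int n) * t + (- \<theta> - real n * v))) / real (Suc j) powr r)"
    proof (rule Bochner_Integration.integral_cong[OF refl])
      fix t
      define a b where "a = real (Suc j) * t - \<theta>" and "b = real n * (v - t)"
      have "cos (of_int (int (Suc j) - int n) * t + (real n * v - \<theta>)) = cos (a + b)"
        "cos (of_int (int (Suc j) + int n) * t + (- \<theta> - real n * v)) = cos (a - b)"
        by (simp_all add: a_def b_def algebra_simps)
      then show "cos (real n * (v - t)) * psi_term r \<theta> j t
          = (cos (of_int (int (Suc j) - int n) * t + (real n * v - \<theta>)) +
            cos (of_int (int (Suc j) + int n) * t + (- \<theta> - real n * v))) / real (Suc j) powr r"
        unfolding psi_term_def a_def[symmetric] b_def[symmetric] by (simp add: cos_add cos_diff)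
    qed
    also have "\<dots> = ((LINT t|period. cos (of_int (int (Suc j) - int n) * t + (real n * v - \<theta>))) +
            (LINT t|period. cos (of_int (int (Suc j) + int n) * t + (- \<theta> - real n * v)))) / real (Suc j) powr r"
      by (simp del: of_nat_Suc of_int_diff of_int_add add: integrable_period_bounded[where B = 1])
    also have "\<dots> = (if Suc j = n then pi * psi_term r \<theta> j v else 0)"
      unfolding integral_period_cos by (auto simp: psi_term_def)
    finally show ?thesis .
  qed
  have "(\<lambda>j. LINT t|period. cos (real n * (v - t)) * psi_term r \<theta> j t) sums (LINT t|period. cos (real n * (v - t)) * P t)"
    by (intro bounded_sums_integral[OF assms] integrable_period_bounded[where B = 1]) auto
  moreover have "(\<lambda>j. LINT t|period. cos (real n * (v - t)) * psi_term r \<theta> j t) sums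
      (if n = 0 then 0 else pi * psi_term r \<theta> (n - 1) v)"
  proof (cases n)
    case 0
    then show ?thesis unfolding single by simp
  next
    case (Suc k)
    then show ?thesis
      unfolding single using sums_single[of k "\<lambda>j. pi * psi_term r \<theta> j v"] by (simp add: eq_commute)
  qed
  ultimately show ?thesis by (rule sums_unique2)
qed

text \<open>A Fourier multiplier acts on a convolution through its kernel: the harmonic of order
  \<open>n\<close> of the convolution involves only the term of frequency \<open>n\<close> of
  \<open>P\<close>.\<close>

lemma cesaro_mean_convolution:
  fixes g :: "real \<Rightarrow> real"
  assumes P: "bounded_sums (psi_term r \<theta>) P B"
    and g [measurable]: "g \<in> borel_measurable borel" and per: "\<And>t. g (t + 2 * pi) = g t"
    and int: "integrable period g"
  shows "cesaro_mean \<alpha> m (\<lambda>x. 1 / (2 * pi) * (LINT t|period. g (x - t) * P t)) x =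
    1 / (2 * pi) * (LINT t|period. g (x - t) *
      (\<Sum>j<m. cesaro_number \<alpha> (int m - int (Suc j)) / cesaro_number \<alpha> (int m) * psi_term r \<theta> j t))"
proof -
  define f where "f x = 1 / (2 * pi) * (LINT t|period. g (x - t) * P t)" for x
  have [measurable]: "P \<in> borel_measurable borel"
    by (rule bounded_sums_measurable[OF P])
  note P_le = bounded_sums_le[OF P]
  have gx: "integrable period (\<lambda>v. g (x - v))" for x
    using int by (simp add: integrable_period_reflect_iff per)
  have f_int: "integrable period f"
  proof (rule integrable_period_bounded)
    note [measurable] = measurable_ident_period
    have "P \<in> borel_measurable period" by (rule borel_measurable_periodI) measurable
    then show "f \<in> borel_measurable borel"
      unfolding f_def by measurable
    show "\<bar>f x\<bar> \<le> 1 / (2 * pi) * (B * (LINT t|period. \<bar>g t\<bar>))" for x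
    proof -
      have gP: "integrable period (\<lambda>t. g (x - t) * P t)"
        by (rule integrable_period_mult_bounded[OF gx _ P_le]) measurable
      have "\<bar>LINT t|period. g (x - t) * P t\<bar> \<le> (LINT t|period. \<bar>g (x - t) * P t\<bar>)"
        by (rule integral_abs_bound)
      also have "\<dots> \<le> (LINT t|period. B * \<bar>g (x - t)\<bar>)"
      proof (rule integral_mono)
        show "\<bar>g (x - t) * P t\<bar> \<le> B * \<bar>g (x - t)\<bar>" for t
          using mult_right_mono[OF P_le[of t] abs_ge_zero[of "g (x - t)"]] by (simp add: abs_mult mult.commute)
        show "integrable period (\<lambda>t. \<bar>g (x - t) * P t\<bar>)" by (intro integrable_abs gP)
      qed (use gx[of x] in simp)
      also have "\<dots> = B * (LINT t|period. \<bar>g t\<bar>)"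
        using integral_period_reflect[of "\<lambda>t. \<bar>g t\<bar>" x] by (simp add: per)
      finally show ?thesis
        by (simp add: f_def abs_mult divide_right_mono)
    qed
  qed
  have coeff: "(LINT t|period. f t * cos (real n * (y - t))) =
      (if n = 0 then 0 else 1 / 2 * (LINT v|period. g (y - v) * psi_term r \<theta> (n - 1) v))" for n y
  proof -
    have "(LINT t|period. f t * cos (real n * (y - t))) =
      1 / (2 * pi) * (LINT v|period. g (y - v) * (LINT t|period. cos (real n * (v - t)) * P t))"
      unfolding integral_convolution_cos[OF g per int \<open>P \<in> borel_measurable borel\<close> P_le, symmetric]
      by (simp add: f_def)
    then show ?thesis
      unfolding integral_psi_cos[OF P] by (auto simp: mult.left_commute[of _ pi])
  qed
  have "cesaro_mean \<alpha> m f x = 1 / pi * (\<Sum>j<m. cesaro_number \<alpha> (int m - int (Suc j)) /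
      cesaro_number \<alpha> (int m) * (1 / 2 * (LINT v|period. g (x - v) * psi_term r \<theta> j v)))"
    using cesaro_mean_eq[OF f_int, of x \<alpha> m] unfolding coeff by simp
  also have "\<dots> = 1 / (2 * pi) * (\<Sum>j<m. LINT v|period. cesaro_number \<alpha> (int m - int (Suc j)) /
      cesaro_number \<alpha> (int m) * (g (x - v) * psi_term r \<theta> j v))"
    unfolding Bochner_Integration.integral_mult_right_zero sum_distrib_left by (intro sum.cong) auto
  also have "(\<Sum>j<m. LINT v|period. cesaro_number \<alpha> (int m - int (Suc j)) /
      cesaro_number \<alpha> (int m) * (g (x - v) * psi_term r \<theta> j v)) =
    (LINT v|period. (\<Sum>j<m. cesaro_number \<alpha> (int m - int (Suc j)) /
      cesaro_number \<alpha> (int m) * (g (x - v) * psi_term r \<theta> j v)))"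
  proof (rule Bochner_Integration.integral_sum[symmetric])
    fix j
    have "integrable period (\<lambda>v. g (x - v) * psi_term r \<theta> j v)"
    proof (rule integrable_period_mult_bounded[OF gx])
      show "\<bar>psi_term r \<theta> j v\<bar> \<le> 2 / real (Suc j) powr r" for v
        by (simp add: psi_term_def abs_mult divide_right_mono del: of_nat_Suc)
      show "psi_term r \<theta> j \<in> borel_measurable borel"
        using P by (simp add: bounded_sums_def)
    qed
    then show "integrable period (\<lambda>v. cesaro_number \<alpha> (int m - int (Suc j)) /
      cesaro_number \<alpha> (int m) * (g (x - v) * psi_term r \<theta> j v))"
      by simp
  qed
  finally show ?thesis
    unfolding f_def by (simp add: sum_distrib_left mult_ac)
qed

subsection \<open>The kernel of the approximation error\<close>

lemma cos_half_pi_odd: "odd (\<beta> :: int) \<Longrightarrow> cos (of_int \<beta> * pi / 2 :: real) = 0"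
  unfolding cos_zero_iff_int by (intro exI[of _ \<beta>]) simp

lemma sin_half_pi_even: "even (\<beta> :: int) \<Longrightarrow> sin (of_int \<beta> * pi / 2 :: real) = 0"
  unfolding sin_zero_iff_int by (intro exI[of _ \<beta>]) simp

text \<open>For integer \<open>\<beta>\<close> one of \<open>cos \<theta>\<close> and
  \<open>sin \<theta>\<close> vanishes, so \<open>psi\<close> is a pure sine series (odd
  \<open>\<beta>\<close>) or a pure cosine series (even \<open>\<beta>\<close>).\<close>

lemma bounded_sums_psi:
  fixes \<beta> :: int
  defines "\<theta> \<equiv> of_int \<beta> * pi / 2"
  assumes "odd \<beta> \<and> (r = 1 \<or> 2 \<le> r) \<or> even \<beta> \<and> 2 \<le> r"
  shows "\<exists>B. bounded_sums (psi_term r \<theta>) (psi r (of_int \<beta>)) B"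
proof -
  have psi: "psi r (of_int \<beta>) = (\<lambda>t. \<Sum>j. psi_term r \<theta> j t)"
    by (simp add: fun_eq_iff psi_def psi_term_def \<theta>_def)
  have "\<exists>U B. bounded_sums (psi_term r \<theta>) U B"
  proof (cases "odd \<beta>")
    case True
    then obtain B where "bounded_sums (\<lambda>j t. sin (real (Suc j) * t) / real (Suc j) powr r)
      (\<lambda>t. \<Sum>j. sin (real (Suc j) * t) / real (Suc j) powr r) B"
      using bounded_sums_sin[of r] assms(2) by auto
    from bounded_sums_cmult[OF this, of "2 * sin \<theta>"] show ?thesis
      using cos_half_pi_odd[OF True] unfolding psi_term_def[abs_def] cos_diff \<theta>_def[symmetric]
      by (auto simp: mult_ac)
  next
    case False
    then have "2 \<le> r" using assms(2) by auto
    from bounded_sums_cmult[OF bounded_sums_cos[OF this], of "2 * cos \<theta>"] show ?thesis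
      using sin_half_pi_even[of \<beta>] False unfolding psi_term_def[abs_def] cos_diff \<theta>_def[symmetric]
      by (auto simp: mult_ac)
  qed
  then obtain U B where U: "bounded_sums (psi_term r \<theta>) U B" by blast
  then have "U = (\<lambda>t. \<Sum>j. psi_term r \<theta> j t)"
    by (auto simp: bounded_sums_def sums_iff)
  with U psi show ?thesis by auto
qed

definition cesaro_weight :: "real \<Rightarrow> nat \<Rightarrow> nat \<Rightarrow> real"
  where "cesaro_weight \<alpha> m j = cesaro_number \<alpha> (int m - int (Suc j)) / cesaro_number \<alpha> (int m)"

lemma cesaro_weight_eq_0: "m \<le> j \<Longrightarrow> cesaro_weight \<alpha> m j = 0"
  by (simp add: cesaro_weight_def cesaro_number_def)

definition defect_kernel :: "real \<Rightarrow> int \<Rightarrow> real \<Rightarrow> nat \<Rightarrow> real \<Rightarrow> real"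
  where "defect_kernel r \<beta> \<alpha> m t = psi r (of_int \<beta>) t -
    (\<Sum>j<m. cesaro_weight \<alpha> m j * psi_term r (of_int \<beta> * pi / 2) j t)"

lemma sine_defect_nonneg:
  assumes "q = 1 \<or> 2 \<le> q" "0 \<le> t" "t \<le> pi" "1 \<le> \<alpha>"
    and "(\<lambda>j. (1 - cesaro_weight \<alpha> m j) * (sin (real (Suc j) * t) / real (Suc j) powr q)) sums x"
  shows "0 \<le> x"
  using cesaro_sine_series(2)[OF assms(1-4), of m] assms(5)
  by (simp add: sums_iff cesaro_weight_def del: of_nat_Suc)

text \<open>The cosine series is not differentiated termwise, since for \<open>q = 1\<close> the
  sine series does not converge uniformly. Instead the sine series is integrated termwise over
  \<open>{a..b}\<close>, by testing it against the indicator \<open>h\<close>.\<close>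

lemma cosine_defect_antimono:
  assumes q: "q = 1 \<or> 2 \<le> q" and ab: "0 \<le> a" "a \<le> b" "b \<le> pi" and "1 \<le> \<alpha>"
    and sums: "\<And>t. (\<lambda>j. (1 - cesaro_weight \<alpha> m j) * (cos (real (Suc j) * t) / real (Suc j) powr (q + 1))) sums C t"
  shows "C b \<le> C a"
proof -
  obtain B where B: "bounded_sums (\<lambda>j t. sin (real (Suc j) * t) / real (Suc j) powr q)
      (\<lambda>t. \<Sum>j. sin (real (Suc j) * t) / real (Suc j) powr q) B"
    using bounded_sums_sin[OF q] by blast
  define Q where "Q t = (\<Sum>j. sin (real (Suc j) * t) / real (Suc j) powr q) -
    (\<Sum>j<m. cesaro_weight \<alpha> m j * (sin (real (Suc j) * t) / real (Suc j) powr q))" for t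
  note weighted = bounded_sums_weighted[where m = m and w = "cesaro_weight \<alpha> m", OF B cesaro_weight_eq_0, folded Q_def]
  define h where "h = (indicator {a..b} :: real \<Rightarrow> real)"
  have h_int: "integrable period h"
    unfolding h_def by (intro integrable_period_bounded[where B = 1]) (auto simp: indicator_def)
  have sin_int: "(LINT t|period. h t * (sin (real (Suc j) * t) / real (Suc j) powr q)) =
      (cos (real (Suc j) * a) - cos (real (Suc j) * b)) / real (Suc j) powr (q + 1)" for j
  proof -
    let ?f = "\<lambda>t. sin (real (Suc j) * t) / real (Suc j) powr q"
    define F where "F t = - cos (real (Suc j) * t) / real (Suc j) powr (q + 1)" for t
    have cont: "continuous_on {-pi..pi} ?f"
      by (intro continuous_intros) auto
    have "integrable period (\<lambda>t. ?f t * h t)"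
      using h_def by (intro integrable_period_mult_bounded[where B = 1] continuous_imp_integrable_real cont)
        (auto simp: indicator_def)
    then have "(LINT t|period. ?f t * h t) = integral {-pi..pi} (\<lambda>t. ?f t * h t)"
      by (rule lebesgue_integral_eq_integral) simp
    also have "\<dots> = integral {-pi..pi} (\<lambda>t. if t \<in> {a..b} then ?f t else 0)"
      by (intro arg_cong[where f = "integral _"]) (auto simp: h_def indicator_def)
    also have "\<dots> = integral ({a..b} \<inter> {-pi..pi}) ?f"
      by (rule integral_restrict_Int)
    also have "{a..b} \<inter> {-pi..pi} = {a..b}"
      using ab by auto
    also have "(?f has_integral F b - F a) {a..b}"
    proof (rule fundamental_theorem_of_calculus[OF ab(2)])
      fix t
      have "(F has_field_derivative sin (real (Suc j) * t) * real (Suc j) / real (Suc j) powr (q + 1)) (at t)"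
        unfolding F_def by (auto intro!: derivative_eq_intros simp del: of_nat_Suc)
      also have "sin (real (Suc j) * t) * real (Suc j) / real (Suc j) powr (q + 1) = ?f t"
        by (simp add: powr_add del: of_nat_Suc)
      finally show "(F has_vector_derivative ?f t) (at t within {a..b})"
        unfolding has_real_derivative_iff_has_vector_derivative[symmetric] by (rule has_field_derivative_at_within)
    qed
    then have "integral {a..b} ?f = F b - F a"
      by (rule integral_unique)
    finally show ?thesis
      by (simp add: F_def mult.commute diff_divide_distrib del: of_nat_Suc)
  qed
  have "(\<lambda>j. (1 - cesaro_weight \<alpha> m j) * (cos (real (Suc j) * a) / real (Suc j) powr (q + 1)) -
      (1 - cesaro_weight \<alpha> m j) * (cos (real (Suc j) * b) / real (Suc j) powr (q + 1))) sums (C a - C b)"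
    by (intro sums_diff sums)
  moreover have "(\<lambda>j. (1 - cesaro_weight \<alpha> m j) * (cos (real (Suc j) * a) / real (Suc j) powr (q + 1)) -
      (1 - cesaro_weight \<alpha> m j) * (cos (real (Suc j) * b) / real (Suc j) powr (q + 1))) sums (LINT t|period. h t * Q t)"
    using weighted(2)[OF _ h_int] unfolding sin_int
    by (simp add: diff_divide_distrib right_diff_distrib del: of_nat_Suc)
  ultimately have "C a - C b = (LINT t|period. h t * Q t)"
    by (rule sums_unique2)
  also have "\<dots> \<ge> 0"
  proof (rule integral_nonneg_AE, intro AE_I2)
    fix t
    show "0 \<le> h t * Q t"
      using sine_defect_nonneg[OF q _ _ \<open>1 \<le> \<alpha>\<close> weighted(1)[of t]] ab
      by (auto simp: h_def indicator_def)
  qed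
  finally show ?thesis by simp
qed

lemma sgn_cos_shift_isCont: "AE t in period. isCont (\<lambda>t. sgn (cos (t - \<theta>))) t"
proof -
  \<comment> \<open>All multiples of \<open>pi / 2\<close> are removed, a countable set containing
    every zero of \<open>cos (t - \<theta>)\<close>.\<close>
  have "countable (range (\<lambda>i::int. \<theta> + of_int i * (pi / 2)))"
    by simp
  then have "AE t in lborel. t \<notin> range (\<lambda>i::int. \<theta> + of_int i * (pi / 2))"
    by (intro AE_not_in countable_imp_null_set_lborel)
  then show ?thesis
    unfolding AE_period_iff
  proof eventually_elim
    case (elim t)
    have "cos (t - \<theta>) \<noteq> 0"
    proof
      assume "cos (t - \<theta>) = 0"
      then obtain i :: int where "t - \<theta> = of_int i * (pi / 2)"
        unfolding cos_zero_iff_int by auto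
      then have "t = \<theta> + of_int i * (pi / 2)" by simp
      with elim show False by blast
    qed
    then show ?case by (intro impI continuous_intros)
  qed
qed

text \<open>For odd \<open>\<beta>\<close> the constant is 0: kernel and \<open>s\<close> are odd up
  to the common sign \<open>sin \<theta>\<close>, and positivity is needed on the half period only.
  For even \<open>\<beta>\<close> it is the value at \<open>pi / 2\<close>: the kernel is even and,
  up to the sign \<open>cos \<theta>\<close>, decreasing on \<open>{0..pi}\<close>, so it crosses
  this value where the cosine changes sign.\<close>

lemma defect_kernel_sign:
  fixes \<beta> :: int
  assumes "odd \<beta> \<and> (r = 1 \<or> 2 \<le> r) \<or> even \<beta> \<and> (r = 2 \<or> 3 \<le> r)" and "1 \<le> \<alpha>"
  obtains c where "\<And>t. t \<in> {-pi..pi} \<Longrightarrow>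
    (defect_kernel r \<beta> \<alpha> m t - c) * sgn (cos (t - of_int \<beta> * pi / 2)) = \<bar>defect_kernel r \<beta> \<alpha> m t - c\<bar>"
proof -
  define \<theta> :: real where "\<theta> = of_int \<beta> * pi / 2"
  define K where "K = defect_kernel r \<beta> \<alpha> m"
  have "odd \<beta> \<and> (r = 1 \<or> 2 \<le> r) \<or> even \<beta> \<and> 2 \<le> r" using assms(1) by auto
  then obtain B where B: "bounded_sums (psi_term r \<theta>) (psi r (of_int \<beta>)) B"
    using bounded_sums_psi unfolding \<theta>_def by blast
  have K: "(\<lambda>j. (1 - cesaro_weight \<alpha> m j) * psi_term r \<theta> j t) sums K t" for t
    using bounded_sums_weighted(1)[where m = m and w = "cesaro_weight \<alpha> m", OF B cesaro_weight_eq_0]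
    by (simp add: K_def defect_kernel_def[abs_def] \<theta>_def)
  \<comment> \<open>Here \<open>e\<close> is \<open>sin \<theta>\<close> or
    \<open>cos \<theta>\<close>; the premise for \<open>y = 0\<close> covers the points where
    \<open>s\<close> is 0.\<close>
  have sign_eq: "x * (e * sgn y) = \<bar>x\<bar>" if "e\<^sup>2 = 1" "x = e * z" "y = 0 \<Longrightarrow> z = 0" "0 \<le> z * y" for x y z e :: real
  proof -
    have e: "e = 1 \<or> e = - 1" using that(1) by (simp add: power2_eq_1_iff)
    then show ?thesis
      using that(2-4) by (cases "y = 0"; cases "0 < y") (auto simp: zero_le_mult_iff)
  qed
  show ?thesis
  proof (cases "odd \<beta>")
    case True
    then have cos_\<theta>: "cos \<theta> = 0" and q: "r = 1 \<or> 2 \<le> r"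
      using cos_half_pi_odd assms(1) by (auto simp: \<theta>_def)
    then have sin_\<theta>: "(sin \<theta>)\<^sup>2 = 1"
      using sin_cos_squared_add[of \<theta>] by simp
    define Q where "Q t = (sin \<theta>) * K t / 2" for t
    have Q: "(\<lambda>j. (1 - cesaro_weight \<alpha> m j) * (sin (real (Suc j) * t) / real (Suc j) powr r)) sums Q t" for t
    proof -
      have "(\<lambda>j. sin \<theta> / 2 * ((1 - cesaro_weight \<alpha> m j) * psi_term r \<theta> j t)) sums (sin \<theta> / 2 * K t)"
        by (rule sums_mult[OF K])
      moreover have "sin \<theta> / 2 * ((1 - cesaro_weight \<alpha> m j) * psi_term r \<theta> j t)
          = (sin \<theta>)\<^sup>2 * ((1 - cesaro_weight \<alpha> m j) * (sin (real (Suc j) * t) / real (Suc j) powr r))" for j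
        by (simp add: psi_term_def cos_diff cos_\<theta> power2_eq_square del: of_nat_Suc)
      ultimately show ?thesis by (simp add: sin_\<theta> Q_def del: of_nat_Suc)
    qed
    have odd: "Q (- t) = - Q t" for t
      using sums_minus[OF Q[of t]] Q[of "- t"] by (simp add: sums_iff del: of_nat_Suc)
    have nonneg: "0 \<le> Q t" if "0 \<le> t" "t \<le> pi" for t
      using sine_defect_nonneg[OF q that assms(2) Q] .
    have K_eq: "K t = sin \<theta> * (2 * Q t)" for t
      using sin_\<theta> by (simp add: Q_def power2_eq_square flip: mult.assoc)
    have "(K t - 0) * sgn (cos (t - \<theta>)) = \<bar>K t - 0\<bar>" if "t \<in> {-pi..pi}" for t
    proof -
      have "K t * (sin \<theta> * sgn (sin t)) = \<bar>K t\<bar>"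
      proof (rule sign_eq[OF sin_\<theta> K_eq])
        assume "sin t = 0"
        then obtain i :: int where "t = of_int i * pi" unfolding sin_zero_iff_int2 by blast
        then have "sin (real (Suc j) * t) = 0" for j
          unfolding sin_zero_iff_int2 by (intro exI[of _ "int (Suc j) * i"]) simp
        then show "2 * Q t = 0" using Q[of t] by (simp add: sums_iff del: of_nat_Suc)
      next
        show "0 \<le> 2 * Q t * sin t"
        proof (cases "0 \<le> t")
          case True
          then show ?thesis using that nonneg[of t] sin_ge_zero[of t] by simp
        next
          case False
          then show ?thesis
            using that nonneg[of "- t"] sin_ge_zero[of "- t"] by (simp add: odd mult_nonpos_nonpos)
        qed
      qed
      moreover have "sgn (cos (t - \<theta>)) = sin \<theta> * sgn (sin t)"
      proof -
        have "sgn (sin \<theta>) = sin \<theta>" using sin_\<theta> by (auto simp: power2_eq_1_iff)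
        then show ?thesis by (simp add: cos_diff cos_\<theta> sgn_mult mult.commute)
      qed
      ultimately show ?thesis by simp
    qed
    then show ?thesis using that unfolding K_def \<theta>_def by blast
  next
    case False
    then have sin_\<theta>: "sin \<theta> = 0" and q: "r - 1 = 1 \<or> 2 \<le> r - 1"
      using sin_half_pi_even assms(1) by (auto simp: \<theta>_def)
    then have cos_\<theta>: "(cos \<theta>)\<^sup>2 = 1"
      using sin_cos_squared_add[of \<theta>] by simp
    define C where "C t = (cos \<theta>) * K t / 2" for t
    have C: "(\<lambda>j. (1 - cesaro_weight \<alpha> m j) * (cos (real (Suc j) * t) / real (Suc j) powr (r - 1 + 1))) sums C t" for t
    proof -
      have "(\<lambda>j. cos \<theta> / 2 * ((1 - cesaro_weight \<alpha> m j) * psi_term r \<theta> j t)) sums (cos \<theta> / 2 * K t)"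
        by (rule sums_mult[OF K])
      moreover have "cos \<theta> / 2 * ((1 - cesaro_weight \<alpha> m j) * psi_term r \<theta> j t)
          = (cos \<theta>)\<^sup>2 * ((1 - cesaro_weight \<alpha> m j) * (cos (real (Suc j) * t) / real (Suc j) powr r))" for j
        by (simp add: psi_term_def cos_diff sin_\<theta> power2_eq_square del: of_nat_Suc)
      ultimately show ?thesis by (simp add: cos_\<theta> C_def del: of_nat_Suc)
    qed
    have even: "C \<bar>t\<bar> = C t" for t
      using C[of t] C[of "- t"] by (simp add: sums_iff abs_if del: of_nat_Suc)
    have anti: "C b \<le> C a" if "0 \<le> a" "a \<le> b" "b \<le> pi" for a b
      by (rule cosine_defect_antimono[OF q that assms(2) C])
    have K_eq: "K t - K (pi / 2) = cos \<theta> * (2 * (C t - C (pi / 2)))" for t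
    proof -
      have "cos \<theta> * (2 * (C t - C (pi / 2))) = (cos \<theta>)\<^sup>2 * (K t - K (pi / 2))"
        by (simp add: C_def power2_eq_square algebra_simps)
      then show ?thesis by (simp add: cos_\<theta>)
    qed
    have "(K t - K (pi / 2)) * sgn (cos (t - \<theta>)) = \<bar>K t - K (pi / 2)\<bar>" if "t \<in> {-pi..pi}" for t
    proof -
      have t: "\<bar>t\<bar> \<le> pi" using that by auto
      have cos_abs: "cos t = cos \<bar>t\<bar>" by simp
      have "(K t - K (pi / 2)) * (cos \<theta> * sgn (cos t)) = \<bar>K t - K (pi / 2)\<bar>"
      proof (rule sign_eq[OF cos_\<theta> K_eq])
        assume "cos t = 0"
        then have eq: "\<bar>t\<bar> = pi / 2"
          using t cos_inj_pi[of "\<bar>t\<bar>" "pi / 2"] by simp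
        show "2 * (C t - C (pi / 2)) = 0" using even[of t] unfolding eq by simp
      next
        show "0 \<le> 2 * (C t - C (pi / 2)) * cos t"
        proof (cases "\<bar>t\<bar> \<le> pi / 2")
          case True
          then have "0 \<le> cos \<bar>t\<bar>" by (intro cos_ge_zero) auto
          moreover have "C (pi / 2) \<le> C \<bar>t\<bar>" using True by (intro anti) auto
          ultimately show ?thesis unfolding cos_abs even by simp
        next
          case False
          then have "0 \<le> cos (\<bar>t\<bar> - pi)" using t by (intro cos_ge_zero) auto
          moreover have "C \<bar>t\<bar> \<le> C (pi / 2)" using False t by (intro anti) auto
          ultimately show ?thesis unfolding cos_abs even by (simp add: mult_nonpos_nonpos)
        qed
      qed
      moreover have "sgn (cos (t - \<theta>)) = cos \<theta> * sgn (cos t)"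
      proof -
        have "sgn (cos \<theta>) = cos \<theta>" using cos_\<theta> by (auto simp: power2_eq_1_iff)
        then show ?thesis by (simp add: cos_diff sin_\<theta> sgn_mult mult.commute)
      qed
      ultimately show ?thesis by simp
    qed
    then show ?thesis using that unfolding K_def \<theta>_def by blast
  qed
qed

text \<open>The sign of the final series: for \<open>k = 2 * j + 1\<close> the factor
  \<open>cos ((k - 1) * \<theta>)\<close> is \<open>(- 1) powi (j * \<beta>)\<close> and the sine
  contributes \<open>(- 1) powi j\<close>. Integer powers accommodate negative
  \<open>\<beta>\<close>.\<close>

lemma cos_half_pi_mult: "cos (real j * (of_int \<beta> * pi)) * sin (real (2 * j + 1) * pi / 2) = (- 1) powi (int j * (\<beta> + 1))"
proof -
  have 1: "cos (of_int i * pi) = (- 1 :: real) powi i" for i :: int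
  proof -
    obtain n where "i = int n \<or> i = - int n" by (cases i rule: int_cases2) auto
    then show ?thesis by (auto simp: power_int_minus_one_minus)
  qed
  have "sin (real (2 * j + 1) * pi / 2) = sin (real j * pi + pi / 2)"
    by (simp add: algebra_simps add_divide_distrib)
  also have "\<dots> = cos (of_int (int j) * pi)"
    by (simp add: sin_add)
  finally have 2: "sin (real (2 * j + 1) * pi / 2) = (- 1) powi int j"
    unfolding 1 .
  have "cos (real j * (of_int \<beta> * pi)) = cos (of_int (int j * \<beta>) * pi)"
    by (simp add: mult.assoc)
  then show ?thesis
    unfolding 1 2 by (simp add: power_int_add distrib_left)
qed

section \<open>Evaluation of the error\<close>

lemma approx_error_W1:
  fixes \<beta> :: int
  assumes p: "p = 1 \<or> p = \<infinity>"
    and r: "odd \<beta> \<and> (r = 1 \<or> 2 \<le> r) \<or> even \<beta> \<and> (r = 2 \<or> 3 \<le> r)" and \<alpha>: "1 \<le> \<alpha>"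
  obtains E where "approx_error (W1 r (of_int \<beta>) p) (cesaro_mean \<alpha> m) p = ereal (4 / pi * E)"
    and "(\<lambda>k. (- 1) powi (int k * (\<beta> + 1)) / real (2 * k + 1) powr (r + 1) *
      (1 - cesaro_number \<alpha> (int m - int (2 * k + 1)) / cesaro_number \<alpha> (int m))) sums E"
proof -
  define \<theta> :: real where "\<theta> = of_int \<beta> * pi / 2"
  define K where "K = defect_kernel r \<beta> \<alpha> m"
  define s where "s t = sgn (cos (t - \<theta>))" for t
  have "odd \<beta> \<and> (r = 1 \<or> 2 \<le> r) \<or> even \<beta> \<and> 2 \<le> r" using r by auto
  then obtain B where B: "bounded_sums (psi_term r \<theta>) (psi r (of_int \<beta>)) B"
    using bounded_sums_psi unfolding \<theta>_def by blast
  have K_eq: "K = (\<lambda>t. psi r (of_int \<beta>) t - (\<Sum>j<m. cesaro_weight \<alpha> m j * psi_term r \<theta> j t))"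
    by (simp add: fun_eq_iff K_def defect_kernel_def \<theta>_def)
  note weighted = bounded_sums_weighted[where m = m and w = "cesaro_weight \<alpha> m", OF B cesaro_weight_eq_0]
  obtain C where C: "\<And>t. \<bar>K t\<bar> \<le> C" using weighted(4) unfolding K_eq by auto
  have [measurable]: "K \<in> borel_measurable borel"
    using weighted(3) unfolding K_eq by simp
  have s_meas [measurable]: "s \<in> borel_measurable borel"
    unfolding s_def by measurable
  have s_le: "\<bar>s t\<bar> \<le> 1" for t by (simp add: s_def abs_sgn_eq)
  obtain c where c: "\<And>t. t \<in> {-pi..pi} \<Longrightarrow> (K t - c) * s t = \<bar>K t - c\<bar>"
    using defect_kernel_sign[OF r \<alpha>] unfolding K_def s_def \<theta>_def by blast
  interpret signed_kernel K s c C
  proof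
    show "s (t + pi) = - s t" for t
    proof -
      have "cos (t + pi - \<theta>) = cos ((t - \<theta>) + pi)" by (simp add: algebra_simps)
      then show ?thesis by (simp add: s_def sgn_minus)
    qed
    show "AE t in period. isCont s t"
      using sgn_cos_shift_isCont[of \<theta>] by (simp add: s_def[abs_def])
  qed (use C s_le c in auto)
  \<comment> \<open>The defect of a convolution is the convolution with \<open>psi\<close> minus the
    weighted polynomial, that is with \<open>K\<close>. It is computed for a Borel version
    \<open>g\<close> and carried back, as the convolutions agree at every point.\<close>
  have conv: "1 / (2 * pi) * (LINT t|period. \<phi> (x - t) * psi r (of_int \<beta>) t) -
      cesaro_mean \<alpha> m (\<lambda>x. 1 / (2 * pi) * (LINT t|period. \<phi> (x - t) * psi r (of_int \<beta>) t)) x = conv \<phi> x"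
    if \<phi>: "\<phi> \<in> H1 p" for \<phi> x
  proof -
    obtain g where g: "g \<in> borel_measurable borel" "\<And>t. g (t + 2 * pi) = g t"
      "AE t in lborel. \<phi> t = g t" "integrable period g"
      using H1_borel_version[OF p \<phi>] by blast
    have \<phi>m: "\<phi> \<in> borel_measurable lebesgue"
      using \<phi> by (simp add: H1_def Lp_space_def)
    have psi_meas: "psi r (of_int \<beta>) \<in> borel_measurable borel"
      by (rule bounded_sums_measurable[OF B])
    have term_meas [measurable]: "psi_term r \<theta> j \<in> borel_measurable borel" for j
      using B by (simp add: bounded_sums_def)
    define T where "T t = (\<Sum>j<m. cesaro_weight \<alpha> m j * psi_term r \<theta> j t)" for t
    have gx: "integrable period (\<lambda>t. g (x - t))"
      using g by (simp add: integrable_period_reflect_iff)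
    have T_meas: "T \<in> borel_measurable borel"
      unfolding T_def by measurable
    have T_le: "\<bar>T t\<bar> \<le> B + C" for t
      using bounded_sums_le[OF B, of t] C[of t] unfolding K_eq T_def by linarith
    have "(LINT t|period. g (x - t) * psi r (of_int \<beta>) t) - (LINT t|period. g (x - t) * T t)
        = (LINT t|period. g (x - t) * psi r (of_int \<beta>) t - g (x - t) * T t)"
      by (intro Bochner_Integration.integral_diff[symmetric]
          integrable_period_mult_bounded[OF gx psi_meas bounded_sums_le[OF B]]
          integrable_period_mult_bounded[OF gx T_meas T_le])
    also have "\<dots> = (LINT t|period. g (x - t) * K t)"
      by (simp add: K_eq T_def right_diff_distrib)
    finally have "(LINT t|period. g (x - t) * psi r (of_int \<beta>) t) - (LINT t|period. g (x - t) * T t)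
        = (LINT t|period. g (x - t) * K t)" .
    then have "conv g x = 1 / (2 * pi) * (LINT t|period. g (x - t) * psi r (of_int \<beta>) t) -
        1 / (2 * pi) * (LINT t|period. g (x - t) * T t)"
      unfolding conv_def right_diff_distrib[symmetric] by simp
    also have "1 / (2 * pi) * (LINT t|period. g (x - t) * T t) =
        cesaro_mean \<alpha> m (\<lambda>x. 1 / (2 * pi) * (LINT t|period. g (x - t) * psi r (of_int \<beta>) t)) x"
      unfolding cesaro_mean_convolution[OF B g(1,2,4)] T_def cesaro_weight_def ..
    finally have "conv g x = 1 / (2 * pi) * (LINT t|period. g (x - t) * psi r (of_int \<beta>) t) -
        cesaro_mean \<alpha> m (\<lambda>x. 1 / (2 * pi) * (LINT t|period. g (x - t) * psi r (of_int \<beta>) t)) x" .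
    moreover have "conv \<phi> x = conv g x"
      unfolding conv_def using g \<phi>m by (subst integral_period_conv_cong) auto
    ultimately show ?thesis
      using integral_period_conv_cong[OF \<phi>m g(1) psi_meas g(3)] by simp
  qed
  have W1_eq: "W1 r (of_int \<beta>) p =
      (\<lambda>\<phi> x. 1 / (2 * pi) * (LINT t|period. \<phi> (x - t) * psi r (of_int \<beta>) t)) ` H1 p"
    unfolding W1_def by (auto simp: fun_eq_iff)
  have "approx_error (W1 r (of_int \<beta>) p) (cesaro_mean \<alpha> m) p = ereal E"
    unfolding approx_error_def W1_eq image_image using conv
    by (subst SUP_conv[OF p, symmetric]) (intro SUP_cong, simp_all)
  moreover have "(\<lambda>k. (- 1) powi (int k * (\<beta> + 1)) / real (2 * k + 1) powr (r + 1) *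
      (1 - cesaro_number \<alpha> (int m - int (2 * k + 1)) / cesaro_number \<alpha> (int m))) sums (pi / 4 * E)"
  proof -
    have s_int: "integrable period s"
      using s_le by (intro integrable_period_bounded) auto
    \<comment> \<open>The factor 8 is 2 from \<open>psi_term\<close> times 4 from the integral
      against \<open>s\<close>; with the \<open>1 / (2 * pi)\<close> in \<open>E\<close> it becomes
      \<open>4 / pi\<close>.\<close>
    have coeff: "(LINT t|period. s t * psi_term r \<theta> j t) =
        8 * (cos (real j * \<theta>) * sin (real (Suc j) * pi / 2)) / real (Suc j) powr (r + 1)" for j
    proof -
      have "(LINT t|period. s t * psi_term r \<theta> j t)
          = 2 / real (Suc j) powr r * (LINT t|period. sgn (cos (t - \<theta>)) * cos (real (Suc j) * t - \<theta>))"
        unfolding Bochner_Integration.integral_mult_right_zero[symmetric]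
        by (intro Bochner_Integration.integral_cong) (auto simp: s_def psi_term_def)
      then show ?thesis
        unfolding integral_period_sgn_cos[OF zero_less_Suc] by (simp add: powr_add)
    qed
    have "(\<lambda>j. (1 - cesaro_weight \<alpha> m j) * (LINT t|period. s t * psi_term r \<theta> j t)) sums (LINT t|period. s t * K t)"
      using weighted(2)[OF _ s_int] unfolding K_eq by simp
    then have "(\<lambda>j. 1 / 8 * ((1 - cesaro_weight \<alpha> m j) * (LINT t|period. s t * psi_term r \<theta> j t))) sums
        (1 / 8 * (LINT t|period. s t * K t))"
      by (rule sums_mult)
    also have "1 / 8 * (LINT t|period. s t * K t) = pi / 4 * E"
      by (simp add: E_def mult.commute)
    finally have *: "(\<lambda>j. 1 / 8 * ((1 - cesaro_weight \<alpha> m j) * (LINT t|period. s t * psi_term r \<theta> j t))) sums (pi / 4 * E)" .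
    \<comment> \<open>Index \<open>j\<close> stands for frequency \<open>Suc j\<close>: odd
      \<open>j\<close> give even frequencies, where the sine vanishes, and \<open>j = 2 * k\<close>
      gives \<open>2 * k + 1\<close>.\<close>
    have "strict_mono (\<lambda>k::nat. 2 * k)" by (rule strict_monoI) simp
    moreover have "1 / 8 * ((1 - cesaro_weight \<alpha> m j) * (LINT t|period. s t * psi_term r \<theta> j t)) = 0"
      if "j \<notin> range (\<lambda>k. 2 * k)" for j
    proof -
      have "odd j" using that by (auto elim: evenE)
      then obtain i where "j = 2 * i + 1" by (elim oddE)
      then have "real (Suc j) * pi / 2 = real (Suc i) * pi" by (simp add: algebra_simps)
      then have "sin (real (Suc j) * pi / 2) = 0" by (simp only: sin_npi)
      then show ?thesis unfolding coeff by simp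
    qed
    ultimately have "(\<lambda>k. 1 / 8 * ((1 - cesaro_weight \<alpha> m (2 * k)) * (LINT t|period. s t * psi_term r \<theta> (2 * k) t))) sums (pi / 4 * E)"
      using * by (subst sums_mono_reindex[where g = "\<lambda>k. 2 * k"]) auto
    moreover have "1 / 8 * ((1 - cesaro_weight \<alpha> m (2 * k)) * (LINT t|period. s t * psi_term r \<theta> (2 * k) t)) =
        (- 1) powi (int k * (\<beta> + 1)) / real (2 * k + 1) powr (r + 1) *
      (1 - cesaro_number \<alpha> (int m - int (2 * k + 1)) / cesaro_number \<alpha> (int m))" for k
    proof -
      have eq: "real (2 * k) * \<theta> = real k * (of_int \<beta> * pi)" by (simp add: \<theta>_def)
      show ?thesis
        unfolding coeff eq cesaro_weight_def cos_half_pi_mult[symmetric] Suc_eq_plus1 by simp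
    qed
    ultimately show ?thesis by simp
  qed
  ultimately show ?thesis
    by (intro that[of "pi / 4 * E"]) simp_all
qed

theorem mainTheorem6:
  fixes r :: real and \<beta> :: int and p :: ennreal
  assumes "p = 1 \<or> p = \<infinity>"
    and "(odd \<beta> \<and> (r = 1 \<or> r \<ge> 2)) \<or> (even \<beta> \<and> (r = 2 \<or> r \<ge> 3))"
  shows "(\<forall>\<alpha>\<ge>1. \<forall>m::nat.
      approx_error (W1 r (real_of_int \<beta>) p) (cesaro_mean \<alpha> m) p =
        ereal (4 / pi * (\<Sum>k. (- 1) powi (int k * (\<beta> + 1)) / real (2 * k + 1) powr (r + 1) *
          (1 - cesaro_number \<alpha> (int m - int (2 * k + 1)) / cesaro_number \<alpha> (int m))))) \<and>
    (\<forall>\<alpha>\<ge>1. \<forall>\<gamma>\<ge>1. \<forall>m::nat.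
      approx_error (W1 r (real_of_int \<beta>) p) (cesaro_mean \<alpha> m) p =
        ereal (1 / cesaro_number \<alpha> (int m)) *
          (\<Sum>k=0..m. ereal (cesaro_number (\<alpha> - \<gamma> - 1) (int m - int k) * cesaro_number \<gamma> (int k)) *
            approx_error (W1 r (real_of_int \<beta>) p) (cesaro_mean \<gamma> k) p))"
proof -
  define z where "z k = (- 1) powi (int k * (\<beta> + 1)) / real (2 * k + 1) powr (r + 1)" for k
  define d where "d \<alpha> m k = 1 - cesaro_number \<alpha> (int m - int (2 * k + 1)) / cesaro_number \<alpha> (int m)" for \<alpha> m k
  define S where "S \<alpha> m = (\<Sum>k. z k * d \<alpha> m k)" for \<alpha> m
  have error_sums: "approx_error (W1 r (of_int \<beta>) p) (cesaro_mean \<alpha> m) p = ereal (4 / pi * S \<alpha> m) \<and>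
      (\<lambda>k. z k * d \<alpha> m k) sums S \<alpha> m" if \<alpha>: "1 \<le> \<alpha>" for \<alpha> m
  proof -
    obtain E where "approx_error (W1 r (of_int \<beta>) p) (cesaro_mean \<alpha> m) p = ereal (4 / pi * E)"
      and E: "(\<lambda>k. z k * d \<alpha> m k) sums E"
      using approx_error_W1[OF assms \<alpha>, of m] unfolding z_def d_def by blast
    moreover have "E = S \<alpha> m" using E unfolding S_def by (rule sums_unique)
    ultimately show ?thesis by simp
  qed
  note error = error_sums[THEN conjunct1] and sums = error_sums[THEN conjunct2]
  \<comment> \<open>Multiplying \<open>d \<gamma> k i\<close> by the number of order
    \<open>\<gamma>\<close> at \<open>k\<close> clears the denominator and leaves a difference of
    two Cesaro numbers; Vandermonde with orders \<open>\<alpha> - \<gamma> - 1\<close> and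
    \<open>\<gamma>\<close> sums each to order \<open>\<alpha>\<close>. The coefficients may be
    negative, but the identity is algebraic in each term.\<close>
  have recursion: "S \<alpha> m = 1 / cesaro_number \<alpha> (int m) *
      (\<Sum>k=0..m. cesaro_number (\<alpha> - \<gamma> - 1) (int m - int k) * cesaro_number \<gamma> (int k) * S \<gamma> k)"
    if "1 \<le> \<alpha>" "1 \<le> \<gamma>" for \<alpha> \<gamma> m
  proof (rule sums_unique2[OF sums[OF that(1)]])
    have "(\<lambda>i. 1 / cesaro_number \<alpha> (int m) *
        (\<Sum>k=0..m. cesaro_number (\<alpha> - \<gamma> - 1) (int m - int k) * cesaro_number \<gamma> (int k) * (z i * d \<gamma> k i))) sums
      (1 / cesaro_number \<alpha> (int m) *
        (\<Sum>k=0..m. cesaro_number (\<alpha> - \<gamma> - 1) (int m - int k) * cesaro_number \<gamma> (int k) * S \<gamma> k))"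
      by (intro sums_mult sums_sum sums that)
    moreover have "1 / cesaro_number \<alpha> (int m) *
        (\<Sum>k=0..m. cesaro_number (\<alpha> - \<gamma> - 1) (int m - int k) * cesaro_number \<gamma> (int k) * (z i * d \<gamma> k i))
      = z i * d \<alpha> m i" for i
    proof -
      have pos: "0 < cesaro_number \<alpha> (int m)" "0 < cesaro_number \<gamma> (int k)" for k
        using that by (auto intro!: cesaro_number_pos)
      have "(\<Sum>k=0..m. cesaro_number (\<alpha> - \<gamma> - 1) (int m - int k) * cesaro_number \<gamma> (int k) * (z i * d \<gamma> k i))
          = (\<Sum>k=0..m. z i * (cesaro_number (\<alpha> - \<gamma> - 1) (int m - int k) * cesaro_number \<gamma> (int k) -
              cesaro_number (\<alpha> - \<gamma> - 1) (int m - int k) * cesaro_number \<gamma> (int k - int (2 * i + 1))))"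
        using pos(2) by (intro sum.cong) (auto simp: d_def field_simps less_imp_neq[THEN not_sym])
      also have "\<dots> = z i * (cesaro_number \<alpha> (int m) - cesaro_number \<alpha> (int m - int (2 * i + 1)))"
        unfolding sum_distrib_left[symmetric] sum_subtractf cesaro_number_vandermonde cesaro_number_vandermonde_shift
        by simp
      also have "\<dots> = cesaro_number \<alpha> (int m) * (z i * d \<alpha> m i)"
        using pos(1) by (simp add: d_def field_simps)
      finally show ?thesis using pos(1) by simp
    qed
    ultimately show "(\<lambda>i. z i * d \<alpha> m i) sums (1 / cesaro_number \<alpha> (int m) *
        (\<Sum>k=0..m. cesaro_number (\<alpha> - \<gamma> - 1) (int m - int k) * cesaro_number \<gamma> (int k) * S \<gamma> k))"
      by simp
  qed
  show ?thesis
  proof (intro conjI allI impI)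
    fix \<alpha> :: real and m :: nat assume "1 \<le> \<alpha>"
    show "approx_error (W1 r (real_of_int \<beta>) p) (cesaro_mean \<alpha> m) p =
        ereal (4 / pi * (\<Sum>k. (- 1) powi (int k * (\<beta> + 1)) / real (2 * k + 1) powr (r + 1) *
          (1 - cesaro_number \<alpha> (int m - int (2 * k + 1)) / cesaro_number \<alpha> (int m))))"
      unfolding error[OF \<open>1 \<le> \<alpha>\<close>] S_def z_def d_def ..
  next
    fix \<alpha> \<gamma> :: real and m :: nat assume \<alpha>: "1 \<le> \<alpha>" and \<gamma>: "1 \<le> \<gamma>"
    show "approx_error (W1 r (real_of_int \<beta>) p) (cesaro_mean \<alpha> m) p =
        ereal (1 / cesaro_number \<alpha> (int m)) *
          (\<Sum>k=0..m. ereal (cesaro_number (\<alpha> - \<gamma> - 1) (int m - int k) * cesaro_number \<gamma> (int k)) *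
            approx_error (W1 r (real_of_int \<beta>) p) (cesaro_mean \<gamma> k) p)"
      unfolding error[OF \<alpha>] error[OF \<gamma>] recursion[OF \<alpha> \<gamma>, of m]
      by (simp add: sum_distrib_left mult_ac)
  qed
qed

end
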